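(* Let $0<r<1$ and let $T$ be an invertible bounded operator on a complex Hilbert space $\mathcal H$. Then $T\in C_{1,r}$ if and only if there exist a Hilbert space $\mathcal K\supseteq\mathcal H$, an $A_r$-unitary $N$ on $\mathcal K$, and a self-adjoint unitary $F$ on $\mathcal K$ such that $$f(T)=P_{\mathcal H}\Big(p(N)\,q_1(N)^{-1}\,q_2(FNF)^{-1}\Big)\Big|_{\mathcal H}$$ for every rational function $f=\dfrac{p}{q_1q_2}$ with poles off $\overline{A}_r$, where $p,q_1,q_2\in\mathbb C[z]$, all zeros of $q_1$ lie in $\mathbb C\setminus\overline{\mathbb D}$ and all zeros of $q_2$ lie in $r\mathbb D$.
   Context: All operators are bounded linear operators on complex Hilbert spaces. $\mathbb D$ is the open unit disk, $\mathbb T$ the unit circle, $r\mathbb D=\{|z|<r\}$, $r\mathbb T=\{|z|=r\}$, $A_r=\{z\in\mathbb C: r<|z|<1\}$, so $\overline{A}_r=\{r\le|z|\le1\}$ with boundary $\mathbb T\cup r\mathbb T$. $C_{1,r}$ is the class of invertible operators $T$ with $\|T\|\le1$ and $\|rT^{-1}\|\le1$. An $A_r$-unitary is a normal operator whose spectrum is contained in $\mathbb T\cup r\mathbb T$. $P_{\mathcal H}$ is the orthogonal projection of $\mathcal K$ onto $\mathcal H$; the containment $\mathcal K\supseteq\mathcal H$ is up to isometric embedding of $\mathcal H$ as a closed subspace. For $f=p/(q_1q_2)$ as in the claim, $f(T)=p(T)q_1(T)^{-1}q_2(T)^{-1}$, and the displayed identity is understood to include that $f(T)$ is defined (i.e.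 $q_1(T)$ and $q_2(T)$ are invertible). *)

theory Defs
  imports "HOL-Analysis.Analysis" "HOL-Computational_Algebra.Polynomial"
begin

section \<open>Complex Hilbert spaces\<close>

text \<open>The inner product is linear in the first argument. Building on \<^class>\<open>real_normed_vector\<close>
  makes the topology and the operator norm \<^const>\<open>onorm\<close> of the library available.\<close>

class complex_inner = real_normed_vector +
  fixes scaleC :: "complex \<Rightarrow> 'a \<Rightarrow> 'a"  (infixr "*\<^sub>C" 75)
    and cinner :: "'a \<Rightarrow> 'a \<Rightarrow> complex"
  assumes scaleC_add_right: "a *\<^sub>C (x + y) = a *\<^sub>C x + a *\<^sub>C y"
    and scaleC_add_left: "(a + b) *\<^sub>C x = a *\<^sub>C x + b *\<^sub>C x"
    and scaleC_scaleC: "a *\<^sub>C b *\<^sub>C x = (a * b) *\<^sub>C x"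
    and scaleR_scaleC: "s *\<^sub>R x = complex_of_real s *\<^sub>C x"
    and cinner_commute: "cinner x y = cnj (cinner y x)"
    and cinner_add_left: "cinner (x + y) z = cinner x z + cinner y z"
    and cinner_scaleC_left: "cinner (a *\<^sub>C x) y = a * cinner x y"
    and cinner_self: "cinner x x = complex_of_real ((norm x)\<^sup>2)"

class chilbert_space = complex_inner + banach

instantiation complex :: chilbert_space
begin
definition scaleC_complex :: "complex \<Rightarrow> complex \<Rightarrow> complex" where "scaleC_complex a x = a * x"
definition cinner_complex :: "complex \<Rightarrow> complex \<Rightarrow> complex" where "cinner_complex x y = x * cnj y"
instance
  by standard (auto simp: scaleC_complex_def cinner_complex_def algebra_simps scaleR_conv_of_real
      complex_mult_cnj cmod_power2)
end

lemma cinner_add_right: "cinner x (y + z) = cinner x y + cinner x (z :: 'a :: complex_inner)"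
  by (metis cinner_add_left cinner_commute complex_cnj_add)

lemma cinner_scaleC_right: "cinner x (a *\<^sub>C y) = cnj a * cinner x (y :: 'a :: complex_inner)"
  by (metis cinner_commute cinner_scaleC_left complex_cnj_mult)

lemma norm_scaleC: "norm (a *\<^sub>C x) = cmod a * norm (x :: 'a :: complex_inner)"
proof -
  have "complex_of_real ((norm (a *\<^sub>C x))\<^sup>2) = (a * cnj a) * complex_of_real ((norm x)\<^sup>2)"
    by (simp only: cinner_self[symmetric] cinner_scaleC_left cinner_scaleC_right
        mult.assoc mult.left_commute)
  also have "\<dots> = complex_of_real ((cmod a * norm x)\<^sup>2)"
    by (simp add: complex_norm_square[symmetric] power_mult_distrib)
  finally have "(norm (a *\<^sub>C x))\<^sup>2 = (cmod a * norm x)\<^sup>2"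
    by (simp only: of_real_eq_iff)
  then show ?thesis
    by (simp add: power2_eq_iff_nonneg)
qed

lemma cauchy_schwarz: "cmod (cinner x y) \<le> norm x * norm (y :: 'a :: complex_inner)"
proof -
  have Re_le: "Re (cinner u v) \<le> norm u * norm v" for u v :: 'a
  proof -
    have "cinner (u + v) (u + v) = cinner u u + cinner v v + (cinner u v + cnj (cinner u v))"
      by (simp add: cinner_add_left cinner_add_right cinner_commute[of v u])
    then have "Re (cinner (u + v) (u + v)) = Re (cinner u u) + Re (cinner v v) + 2 * Re (cinner u v)"
      by simp
    then have "(norm (u + v))\<^sup>2 = (norm u)\<^sup>2 + (norm v)\<^sup>2 + 2 * Re (cinner u v)"
      by (simp only: cinner_self Re_complex_of_real)
    moreover have "(norm (u + v))\<^sup>2 \<le> (norm u + norm v)\<^sup>2"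
      by (simp add: power_mono norm_triangle_ineq)
    ultimately show ?thesis
      by (simp add: power2_sum)
  qed
  define w where "w = cinner x y"
  show ?thesis
  proof (cases "w = 0")
    case False
    define a where "a = cnj w / complex_of_real (cmod w)"
    have "a * w = complex_of_real (cmod w)"
      using False by (simp add: a_def complex_norm_square[symmetric] power2_eq_square mult.commute)
    moreover have "cmod a = 1"
      using False by (simp add: a_def norm_divide)
    ultimately show ?thesis
      using Re_le[of "a *\<^sub>C x" y] by (simp add: cinner_scaleC_left norm_scaleC flip: w_def)
  qed (simp flip: w_def)
qed

section \<open>Bounded operators\<close>

definition bounded_clinear :: "('a :: complex_inner \<Rightarrow> 'b :: complex_inner) \<Rightarrow> bool" where
  "bounded_clinear T \<longleftrightarrow> bounded_linear T \<and> (\<forall>a x. T (a *\<^sub>C x) = a *\<^sub>C T x)"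

definition invertible_op :: "('a :: complex_inner \<Rightarrow> 'a) \<Rightarrow> bool" where
  "invertible_op T \<longleftrightarrow> bounded_clinear T \<and> bij T \<and> bounded_clinear (inv T)"

text \<open>On a Hilbert space the adjoint of a bounded operator exists and is unique.\<close>

definition cadjoint :: "('a :: complex_inner \<Rightarrow> 'a) \<Rightarrow> 'a \<Rightarrow> 'a" where
  "cadjoint T = (THE S. \<forall>x y. cinner (T x) y = cinner x (S y))"

definition normal_op :: "('a :: complex_inner \<Rightarrow> 'a) \<Rightarrow> bool" where
  "normal_op T \<longleftrightarrow> bounded_clinear T \<and> cadjoint T \<circ> T = T \<circ> cadjoint T"

definition selfadjoint_op :: "('a :: complex_inner \<Rightarrow> 'a) \<Rightarrow> bool" where
  "selfadjoint_op T \<longleftrightarrow> bounded_clinear T \<and> cadjoint T = T"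

definition unitary_op :: "('a :: complex_inner \<Rightarrow> 'a) \<Rightarrow> bool" where
  "unitary_op T \<longleftrightarrow> bounded_clinear T \<and> cadjoint T \<circ> T = id \<and> T \<circ> cadjoint T = id"

definition spectrum :: "('a :: complex_inner \<Rightarrow> 'a) \<Rightarrow> complex set" where
  "spectrum T = {z. \<not> invertible_op (\<lambda>x. T x - z *\<^sub>C x)}"

definition isometry_op :: "('a :: complex_inner \<Rightarrow> 'b :: complex_inner) \<Rightarrow> bool" where
  "isometry_op V \<longleftrightarrow> bounded_clinear V \<and> (\<forall>x. norm (V x) = norm x)"

text \<open>Orthogonal projection onto a closed subspace \<open>M\<close> of a Hilbert space.\<close>

definition orth_proj :: "'a :: complex_inner set \<Rightarrow> 'a \<Rightarrow> 'a" where
  "orth_proj M x = (THE y. y \<in> M \<and> (\<forall>m\<in>M. cinner (x - y) m = 0))"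

definition poly_op :: "complex poly \<Rightarrow> ('a :: complex_inner \<Rightarrow> 'a) \<Rightarrow> 'a \<Rightarrow> 'a" where
  "poly_op p T = (\<lambda>x. \<Sum>i\<le>degree p. coeff p i *\<^sub>C (T ^^ i) x)"

section \<open>The class \<open>C\<^sub>1\<^sub>,\<^sub>r\<close> and its dilations\<close>

definition C1 :: "real \<Rightarrow> ('a :: complex_inner \<Rightarrow> 'a) set" where
  "C1 r = {T. invertible_op T \<and> onorm T \<le> 1 \<and> onorm (\<lambda>x. r *\<^sub>R inv T x) \<le> 1}"

definition annulus_unitary :: "real \<Rightarrow> ('a :: complex_inner \<Rightarrow> 'a) \<Rightarrow> bool" where
  "annulus_unitary r N \<longleftrightarrow> normal_op N \<and> spectrum N \<subseteq> sphere 0 1 \<union> sphere 0 r"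

text \<open>The isometry \<open>V\<close> embeds the space of \<open>T\<close> as the closed subspace \<^term>\<open>range V\<close>. The
  conditions on the zeros exclude \<open>q1 = 0\<close> and \<open>q2 = 0\<close>, and no coprimality is required. That
  \<open>q1(N)\<close> and \<open>q2(FNF)\<close> are invertible follows from the spectrum of \<open>N\<close>.\<close>

definition annulus_dilation ::
  "real \<Rightarrow> ('h :: complex_inner \<Rightarrow> 'h) \<Rightarrow> ('h \<Rightarrow> 'k :: complex_inner) \<Rightarrow> ('k \<Rightarrow> 'k) \<Rightarrow> ('k \<Rightarrow> 'k) \<Rightarrow> bool"
  where
  "annulus_dilation r T V N F \<longleftrightarrow>
     isometry_op V \<and> annulus_unitary r N \<and> selfadjoint_op F \<and> unitary_op F \<and>
     (\<forall>p q1 q2 :: complex poly.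
        (\<forall>z. poly q1 z = 0 \<longrightarrow> z \<notin> cball 0 1) \<longrightarrow> (\<forall>z. poly q2 z = 0 \<longrightarrow> z \<in> ball 0 r) \<longrightarrow>
        invertible_op (poly_op q1 T) \<and> invertible_op (poly_op q2 T) \<and>
        (\<forall>h. V ((poly_op p T \<circ> inv (poly_op q1 T) \<circ> inv (poly_op q2 T)) h) =
             orth_proj (range V)
               ((poly_op p N \<circ> inv (poly_op q1 N) \<circ> inv (poly_op q2 (F \<circ> N \<circ> F))) (V h))))"

section \<open>Square-summable families in a Hilbert space\<close>

text \<open>\<open>('i, 'a) l2\<close> is the Hilbert direct sum of \<open>'i\<close>-many copies of \<open>'a\<close>. The
  existence of a dilation space cannot be expressed by quantifying over types. The sequence space
  \<open>(nat, 'h) l2\<close> can always serve as this space: the smallest subspace of a dilation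
  space that contains \<^term>\<open>range V\<close> and reduces \<open>N\<close> and \<open>F\<close> embeds isometrically into it, and
  on the complement one may take \<open>N\<close> and \<open>F\<close> to be the identity.\<close>

typedef (overloaded) ('i, 'a) l2 =
  "{f :: 'i \<Rightarrow> 'a :: complex_inner. (\<lambda>i. (norm (f i))\<^sup>2) summable_on UNIV}"
  morphisms l2_nth Abs_l2
  by (rule exI[of _ "\<lambda>_. 0"]) simp

setup_lifting type_definition_l2

lemma L2_set_le_iff: "L2_set f A \<le> C \<longleftrightarrow> (\<Sum>i\<in>A. (f i)\<^sup>2) \<le> C\<^sup>2" if "0 \<le> C"
  unfolding L2_set_def using that by (metis real_sqrt_abs abs_of_nonneg real_sqrt_le_iff)

lemma square_summable_if_L2_set_le:
  fixes f :: "'i \<Rightarrow> 'a :: real_normed_vector"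
  assumes le: "\<And>A. finite A \<Longrightarrow> L2_set (\<lambda>i. norm (f i)) A \<le> C"
  shows "(\<lambda>i. (norm (f i))\<^sup>2) summable_on UNIV" and "sqrt (\<Sum>\<^sub>\<infinity>i. (norm (f i))\<^sup>2) \<le> C"
proof -
  have C: "0 \<le> C" using le[of "{}"] by simp
  have fin: "(\<Sum>i\<in>A. (norm (f i))\<^sup>2) \<le> C\<^sup>2" if "finite A" for A
    using le[OF that] C by (simp add: L2_set_le_iff)
  show s: "(\<lambda>i. (norm (f i))\<^sup>2) summable_on UNIV"
    by (rule nonneg_bdd_above_summable_on) (auto intro!: bdd_aboveI2[of _ _ "C\<^sup>2"] fin)
  show "sqrt (\<Sum>\<^sub>\<infinity>i. (norm (f i))\<^sup>2) \<le> C"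
    by (rule real_le_lsqrt[OF C]) (rule infsum_le_finite_sums[OF s fin])
qed

lemma L2_set_le_sqrt_infsum:
  fixes f :: "'i \<Rightarrow> 'a :: real_normed_vector"
  assumes "(\<lambda>i. (norm (f i))\<^sup>2) summable_on UNIV" "finite A"
  shows "L2_set (\<lambda>i. norm (f i)) A \<le> sqrt (\<Sum>\<^sub>\<infinity>i. (norm (f i))\<^sup>2)"
  unfolding L2_set_def by (intro real_sqrt_le_mono finite_sum_le_infsum assms) auto

lemma L2_set_norm_add_le:
  "L2_set (\<lambda>i. norm (f i + g i :: 'a :: real_normed_vector)) A
     \<le> L2_set (\<lambda>i. norm (f i)) A + L2_set (\<lambda>i. norm (g i)) A"
  by (rule order_trans[OF L2_set_mono L2_set_triangle_ineq]) (auto intro: norm_triangle_ineq)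

lemma square_summable_add:
  fixes f g :: "'i \<Rightarrow> 'a :: real_normed_vector"
  assumes "(\<lambda>i. (norm (f i))\<^sup>2) summable_on UNIV" "(\<lambda>i. (norm (g i))\<^sup>2) summable_on UNIV"
  shows "(\<lambda>i. (norm (f i + g i))\<^sup>2) summable_on UNIV"
    and "sqrt (\<Sum>\<^sub>\<infinity>i. (norm (f i + g i))\<^sup>2)
           \<le> sqrt (\<Sum>\<^sub>\<infinity>i. (norm (f i))\<^sup>2) + sqrt (\<Sum>\<^sub>\<infinity>i. (norm (g i))\<^sup>2)"
proof -
  have le: "L2_set (\<lambda>i. norm (f i + g i)) A
      \<le> sqrt (\<Sum>\<^sub>\<infinity>i. (norm (f i))\<^sup>2) + sqrt (\<Sum>\<^sub>\<infinity>i. (norm (g i))\<^sup>2)" if "finite A" for A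
    using L2_set_norm_add_le[of f g A] L2_set_le_sqrt_infsum[OF assms(1) that]
      L2_set_le_sqrt_infsum[OF assms(2) that] by linarith
  show "(\<lambda>i. (norm (f i + g i))\<^sup>2) summable_on UNIV"
    and "sqrt (\<Sum>\<^sub>\<infinity>i. (norm (f i + g i))\<^sup>2)
           \<le> sqrt (\<Sum>\<^sub>\<infinity>i. (norm (f i))\<^sup>2) + sqrt (\<Sum>\<^sub>\<infinity>i. (norm (g i))\<^sup>2)"
    by (rule square_summable_if_L2_set_le[OF le], assumption)+
qed

lemma square_summable_scaleC:
  fixes f :: "'i \<Rightarrow> 'a :: complex_inner"
  assumes "(\<lambda>i. (norm (f i))\<^sup>2) summable_on UNIV"
  shows "(\<lambda>i. (norm (a *\<^sub>C f i))\<^sup>2) summable_on UNIV"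
  using summable_on_cmult_right[OF assms, of "(cmod a)\<^sup>2"]
  by (simp add: norm_scaleC power_mult_distrib)

lemma square_summable_cinner:
  fixes f g :: "'i \<Rightarrow> 'a :: complex_inner"
  assumes "(\<lambda>i. (norm (f i))\<^sup>2) summable_on UNIV" "(\<lambda>i. (norm (g i))\<^sup>2) summable_on UNIV"
  shows "(\<lambda>i. cinner (f i) (g i)) summable_on UNIV"
proof (rule abs_summable_summable, rule Infinite_Sum.abs_summable_on_comparison_test')
  show "(\<lambda>i. (norm (f i))\<^sup>2 + (norm (g i))\<^sup>2) summable_on UNIV"
    using assms by (rule summable_on_add)
  fix i
  have "2 * (norm (f i) * norm (g i)) \<le> (norm (f i))\<^sup>2 + (norm (g i))\<^sup>2"
    using sum_squares_bound[of "norm (f i)" "norm (g i)"] by simp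
  moreover have "0 \<le> norm (f i) * norm (g i)" by simp
  ultimately show "norm (cinner (f i) (g i)) \<le> (norm (f i))\<^sup>2 + (norm (g i))\<^sup>2"
    using cauchy_schwarz[of "f i" "g i"] by linarith
qed

instantiation l2 :: (type, complex_inner) real_vector
begin

lift_definition zero_l2 :: "('a, 'b) l2" is "\<lambda>_. 0" by simp
lift_definition plus_l2 :: "('a, 'b) l2 \<Rightarrow> ('a, 'b) l2 \<Rightarrow> ('a, 'b) l2" is "\<lambda>f g i. f i + g i"
  by (rule square_summable_add)
lift_definition uminus_l2 :: "('a, 'b) l2 \<Rightarrow> ('a, 'b) l2" is "\<lambda>f i. - f i" by simp
lift_definition minus_l2 :: "('a, 'b) l2 \<Rightarrow> ('a, 'b) l2 \<Rightarrow> ('a, 'b) l2" is "\<lambda>f g i. f i - g i"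
  using square_summable_add(1)[of _ "\<lambda>i. - _ i"] by simp
lift_definition scaleR_l2 :: "real \<Rightarrow> ('a, 'b) l2 \<Rightarrow> ('a, 'b) l2" is "\<lambda>a f i. a *\<^sub>R f i"
  using square_summable_scaleC by (simp add: scaleR_scaleC)

instance
proof
  fix x y z :: "('a, 'b) l2" and s t :: real
  show "x + y + z = x + (y + z)" "x + y = y + x" "0 + x = x" "- x + x = 0" "x - y = x + - y"
    by (transfer, simp add: algebra_simps)+
  show "s *\<^sub>R (x + y) = s *\<^sub>R x + s *\<^sub>R y" "(s + t) *\<^sub>R x = s *\<^sub>R x + t *\<^sub>R x"
    "s *\<^sub>R t *\<^sub>R x = (s * t) *\<^sub>R x" "1 *\<^sub>R x = x"
    by (transfer, simp add: algebra_simps)+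
qed

end

instantiation l2 :: (type, complex_inner) complex_inner
begin

lift_definition scaleC_l2 :: "complex \<Rightarrow> ('a, 'b) l2 \<Rightarrow> ('a, 'b) l2" is "\<lambda>a f i. a *\<^sub>C f i"
  by (rule square_summable_scaleC)
lift_definition norm_l2 :: "('a, 'b) l2 \<Rightarrow> real" is "\<lambda>f. sqrt (\<Sum>\<^sub>\<infinity>i. (norm (f i))\<^sup>2)" .
lift_definition cinner_l2 :: "('a, 'b) l2 \<Rightarrow> ('a, 'b) l2 \<Rightarrow> complex" is
  "\<lambda>f g. \<Sum>\<^sub>\<infinity>i. cinner (f i) (g i)" .
definition dist_l2 :: "('a, 'b) l2 \<Rightarrow> ('a, 'b) l2 \<Rightarrow> real" where "dist_l2 x y = norm (x - y)"
definition sgn_l2 :: "('a, 'b) l2 \<Rightarrow> ('a, 'b) l2" where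
  "sgn_l2 x = x /\<^sub>R norm x"
definition uniformity_l2 :: "(('a, 'b) l2 \<times> ('a, 'b) l2) filter" where
  "uniformity_l2 = (INF e\<in>{0 <..}. principal {(x, y). dist x y < e})"
definition open_l2 :: "('a, 'b) l2 set \<Rightarrow> bool" where
  "open_l2 U \<longleftrightarrow> (\<forall>x\<in>U. eventually (\<lambda>(x', y). x' = x \<longrightarrow> y \<in> U) uniformity)"

instance
proof
  fix x y z :: "('a, 'b) l2" and a b :: complex and s :: real and U :: "('a, 'b) l2 set"
  show "a *\<^sub>C (x + y) = a *\<^sub>C x + a *\<^sub>C y" "(a + b) *\<^sub>C x = a *\<^sub>C x + b *\<^sub>C x"
    "a *\<^sub>C b *\<^sub>C x = (a * b) *\<^sub>C x" "s *\<^sub>R x = complex_of_real s *\<^sub>C x"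
    by (transfer, simp add: scaleC_add_left scaleC_add_right scaleC_scaleC scaleR_scaleC)+
  show "dist x y = norm (x - y)" "sgn x = x /\<^sub>R norm x"
    "uniformity = (INF e\<in>{0 <..}. principal {(x, y :: ('a, 'b) l2). dist x y < e})"
    "open U \<longleftrightarrow> (\<forall>x\<in>U. eventually (\<lambda>(x', y). x' = x \<longrightarrow> y \<in> U) uniformity)"
    by (simp_all add: dist_l2_def sgn_l2_def uniformity_l2_def open_l2_def)
  have sq: "(\<lambda>i. (norm (l2_nth x i))\<^sup>2) summable_on UNIV"
    using l2_nth[of x] by simp
  show "norm x = 0 \<longleftrightarrow> x = 0"
  proof
    assume "norm x = 0"
    then have "(norm (l2_nth x i))\<^sup>2 = 0" for i
      by (intro nonneg_infsum_le_0D[OF _ sq]) (auto simp: norm_l2.rep_eq)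
    then show "x = 0"
      by (auto simp: l2_nth_inject[symmetric] zero_l2.rep_eq)
  qed (simp add: norm_l2.rep_eq zero_l2.rep_eq)
  show "norm (x + y) \<le> norm x + norm y"
    by transfer (auto intro: square_summable_add)
  show "norm (s *\<^sub>R x) = \<bar>s\<bar> * norm x"
    by transfer (simp add: power_mult_distrib infsum_cmult_right' real_sqrt_mult)
  show "cinner x y = cnj (cinner y x)"
    by transfer (simp only: infsum_cnj[symmetric] cinner_commute[symmetric])
  show "cinner (x + y) z = cinner x z + cinner y z"
    by transfer (simp add: cinner_add_left infsum_add square_summable_cinner)
  show "cinner (a *\<^sub>C x) y = a * cinner x y"
    by transfer (simp add: cinner_scaleC_left infsum_cmult_right')
  have "((\<lambda>i. complex_of_real ((norm (l2_nth x i))\<^sup>2)) has_sum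
          complex_of_real (\<Sum>\<^sub>\<infinity>i. (norm (l2_nth x i))\<^sup>2)) UNIV"
    using sq by (intro has_sum_of_real has_sum_infsum)
  then have "cinner x x = complex_of_real (\<Sum>\<^sub>\<infinity>i. (norm (l2_nth x i))\<^sup>2)"
    by (simp only: cinner_l2.rep_eq cinner_self infsumI)
  then show "cinner x x = complex_of_real ((norm x)\<^sup>2)"
    by (simp add: norm_l2.rep_eq infsum_nonneg)
qed

end

lemma norm_l2_leI: "(\<And>A. finite A \<Longrightarrow> L2_set (\<lambda>i. norm (l2_nth x i)) A \<le> C) \<Longrightarrow> norm x \<le> C"
  unfolding norm_l2.rep_eq by (rule square_summable_if_L2_set_le)

lemma L2_set_le_norm_l2: "finite A \<Longrightarrow> L2_set (\<lambda>i. norm (l2_nth x i)) A \<le> norm x"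
  unfolding norm_l2.rep_eq using l2_nth[of x] by (intro L2_set_le_sqrt_infsum) auto

lemma norm_l2_nth_le: "norm (l2_nth x i) \<le> norm x"
  using L2_set_le_norm_l2[of "{i}" x] by simp

instance l2 :: (type, chilbert_space) chilbert_space
proof
  fix X :: "nat \<Rightarrow> ('a, 'b) l2"
  assume X: "Cauchy X"
  have "Cauchy (\<lambda>n. l2_nth (X n) i)" for i
    unfolding Cauchy_def
  proof (intro allI impI)
    fix e :: real assume "e > 0"
    with X obtain M where M: "\<And>m n. m \<ge> M \<Longrightarrow> n \<ge> M \<Longrightarrow> norm (X m - X n) < e"
      unfolding Cauchy_def dist_norm by blast
    have "dist (l2_nth (X m) i) (l2_nth (X n) i) < e" if "m \<ge> M" "n \<ge> M" for m n
      using norm_l2_nth_le[of "X m - X n" i] M[OF that] by (simp add: dist_norm minus_l2.rep_eq)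
    then show "\<exists>M. \<forall>m\<ge>M. \<forall>n\<ge>M. dist (l2_nth (X m) i) (l2_nth (X n) i) < e" by blast
  qed
  then obtain g where g: "\<And>i. (\<lambda>n. l2_nth (X n) i) \<longlonglongrightarrow> g i"
    unfolding Cauchy_convergent_iff convergent_def by metis
  have tail: "\<exists>M. \<forall>m\<ge>M. \<forall>A. finite A \<longrightarrow> L2_set (\<lambda>i. norm (l2_nth (X m) i - g i)) A \<le> e"
    if "e > 0" for e
  proof -
    from X that obtain M where M: "\<And>m n. m \<ge> M \<Longrightarrow> n \<ge> M \<Longrightarrow> norm (X m - X n) < e"
      unfolding Cauchy_def dist_norm by blast
    have "L2_set (\<lambda>i. norm (l2_nth (X m) i - g i)) A \<le> e" if m: "m \<ge> M" and A: "finite A" for m A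
    proof (rule tendsto_upperbound)
      show "(\<lambda>n. L2_set (\<lambda>i. norm (l2_nth (X m) i - l2_nth (X n) i)) A)
              \<longlonglongrightarrow> L2_set (\<lambda>i. norm (l2_nth (X m) i - g i)) A"
        unfolding L2_set_def by (intro tendsto_intros g)
      show "\<forall>\<^sub>F n in sequentially. L2_set (\<lambda>i. norm (l2_nth (X m) i - l2_nth (X n) i)) A \<le> e"
        using eventually_ge_at_top[of M]
      proof eventually_elim
        case (elim n)
        then show ?case
          using L2_set_le_norm_l2[OF A, of "X m - X n"] M[OF m elim] by (simp add: minus_l2.rep_eq)
      qed
    qed simp
    then show ?thesis by blast
  qed
  obtain M where M: "\<And>A. finite A \<Longrightarrow> L2_set (\<lambda>i. norm (l2_nth (X M) i - g i)) A \<le> 1"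
    using tail[of 1] by auto
  have "L2_set (\<lambda>i. norm (g i)) A \<le> 1 + norm (X M)" if "finite A" for A
    using L2_set_norm_add_le[of "\<lambda>i. g i - l2_nth (X M) i" "\<lambda>i. l2_nth (X M) i" A]
      M[OF that] L2_set_le_norm_l2[OF that, of "X M"] by (simp add: norm_minus_commute)
  then have "(\<lambda>i. (norm (g i))\<^sup>2) summable_on UNIV"
    by (rule square_summable_if_L2_set_le)
  then have nth: "l2_nth (Abs_l2 g) = g"
    by (simp add: Abs_l2_inverse)
  have "X \<longlonglongrightarrow> Abs_l2 g"
    unfolding LIMSEQ_def
  proof (intro allI impI)
    fix e :: real assume "e > 0"
    then obtain M where M: "\<And>m A. m \<ge> M \<Longrightarrow> finite A \<Longrightarrow> L2_set (\<lambda>i. norm (l2_nth (X m) i - g i)) A \<le> e / 2"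
      using tail[of "e / 2"] by auto
    have "dist (X m) (Abs_l2 g) < e" if "m \<ge> M" for m
    proof -
      have "norm (X m - Abs_l2 g) \<le> e / 2"
        by (rule norm_l2_leI) (simp only: minus_l2.rep_eq nth M[OF that])
      with \<open>e > 0\<close> show ?thesis by (simp add: dist_norm)
    qed
    then show "\<exists>M. \<forall>m\<ge>M. dist (X m) (Abs_l2 g) < e" by blast
  qed
  then show "convergent X" by (auto simp: convergent_def)
qed

end

theory Submission
  imports Defs "HOL-Complex_Analysis.Cauchy_Integral_Formula"
begin

text \<open>For the dilation, lift the commuting contractions \<open>T\<close> and \<open>S = r T\<^sup>-\<^sup>1\<close> to isometries \<open>Y\<close> and
  \<open>Z\<close> on one common space, and extend these to unitaries \<open>U\<close> and \<open>X\<close>. Compression turns every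
  \<open>U\<^sup>n X\<^sup>m\<close> into \<open>T\<^sup>n S\<^sup>m\<close>, although \<open>U\<close> and \<open>X\<close> need not commute. The normal operator
  \<open>N = U \<oplus> r X\<^sup>-\<^sup>1\<close> and the swap \<open>F\<close> of the two summands then do what is required, because the
  inverse of \<open>F N F - b\<close> acts on the first summand as \<open>X (r - b X)\<^sup>-\<^sup>1\<close>.

  Conversely, normality and the spectral condition give \<open>\<parallel>N\<parallel> \<le> 1\<close> and \<open>\<parallel>r N\<^sup>-\<^sup>1\<parallel> \<le> 1\<close>, and the
  identity for \<open>f(z) = z\<close> and \<open>f(z) = 1/z\<close> passes these bounds on to \<open>T\<close>. The spectral radius estimate
  is obtained from Cauchy's inequality for the resolvent.\<close>

section \<open>Bounded operators\<close>

lemma scaleC_simps [simp]: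
  fixes x :: "'a :: complex_inner"
  shows "0 *\<^sub>C x = 0" "1 *\<^sub>C x = x" "a *\<^sub>C (0 :: 'a) = 0" "a *\<^sub>C (- x) = - (a *\<^sub>C x)"
  using scaleR_scaleC[of 0 x] scaleR_scaleC[of 1 x] scaleC_add_right[of a 0 "0 :: 'a"]
    scaleC_add_right[of a x "- x"]
  by (simp_all add: eq_neg_iff_add_eq_0 add.commute)

lemma scaleC_diff_right: "a *\<^sub>C (x - y) = a *\<^sub>C x - a *\<^sub>C (y :: 'a :: complex_inner)"
  using scaleC_add_right[of a x "- y"] by simp

lemma scaleC_minus_left [simp]: "(- a) *\<^sub>C x = - (a *\<^sub>C (x :: 'a :: complex_inner))"
  using scaleC_add_left[of "- a" a x] by (simp add: eq_neg_iff_add_eq_0)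

lemma cinner_0 [simp]: "cinner 0 x = 0" "cinner (x :: 'a :: complex_inner) 0 = 0"
  using cinner_add_left[of 0 0 x] cinner_add_right[of x 0 0] by simp_all

lemma cinner_minus [simp]:
  fixes x :: "'a :: complex_inner"
  shows "cinner (- x) y = - cinner x y" "cinner x (- y) = - cinner x y"
  using cinner_add_left[of "- x" x y] cinner_add_right[of x "- y" y]
  by (simp_all add: eq_neg_iff_add_eq_0)

lemma cinner_diff_left: "cinner (x - y) z = cinner x z - cinner y (z :: 'a :: complex_inner)"
  using cinner_add_left[of x "- y" z] by simp

lemma cinner_diff_right: "cinner x (y - z) = cinner x y - cinner x (z :: 'a :: complex_inner)"
  using cinner_add_right[of x y "- z"] by simp

lemma power2_norm_eq_cinner: "(norm x)\<^sup>2 = Re (cinner x (x :: 'a :: complex_inner))"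
  by (simp add: cinner_self)

lemma power2_norm_add:
  "(norm (x + y))\<^sup>2 = (norm x)\<^sup>2 + (norm y)\<^sup>2 + 2 * Re (cinner x (y :: 'a :: complex_inner))"
  using cinner_commute[of y x]
  by (simp add: power2_norm_eq_cinner cinner_add_left cinner_add_right)

lemma power2_norm_diff:
  "(norm (x - y))\<^sup>2 = (norm x)\<^sup>2 + (norm y)\<^sup>2 - 2 * Re (cinner x (y :: 'a :: complex_inner))"
  using power2_norm_add[of x "- y"] by simp

lemma Im_cinner: "Im (cinner x y) = Re (cinner x (\<i> *\<^sub>C (y :: 'a :: complex_inner)))"
  by (simp add: cinner_scaleC_right)

lemma cinner_ext:
  assumes "\<And>z. cinner z x = cinner z (y :: 'a :: complex_inner)"
  shows "x = y"
proof -
  have "cinner (x - y) (x - y) = 0"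
    using assms[of "x - y"] by (simp add: cinner_diff_right)
  then show ?thesis by (simp add: cinner_self)
qed

lemma bounded_clinearI:
  assumes "\<And>x y. T (x + y) = T x + T y" "\<And>a x. T (a *\<^sub>C x) = a *\<^sub>C T x"
    and "\<And>x. norm (T x) \<le> K * norm x"
  shows "bounded_clinear T"
  unfolding bounded_clinear_def
  by (intro conjI allI bounded_linear_intro[of T K])
    (use assms in \<open>simp_all add: scaleR_scaleC mult.commute\<close>)

context
  fixes T :: "'a :: complex_inner \<Rightarrow> 'b :: complex_inner"
  assumes T: "bounded_clinear T"
begin

lemma bounded_clinear_imp_bounded_linear: "bounded_linear T"
  using T by (simp add: bounded_clinear_def)

lemma bounded_clinear_add: "T (x + y) = T x + T y"
  and bounded_clinear_diff: "T (x - y) = T x - T y"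
  and bounded_clinear_0: "T 0 = 0"
  and bounded_clinear_scaleC: "T (a *\<^sub>C x) = a *\<^sub>C T x"
  and bounded_clinear_scaleR: "T (s *\<^sub>R x) = s *\<^sub>R T x"
  using T bounded_linear.linear[OF bounded_clinear_imp_bounded_linear]
  by (simp_all add: bounded_clinear_def linear_add linear_diff linear_0 linear_scale)

lemma bounded_clinear_bound: "norm (T x) \<le> onorm T * norm x"
  by (rule onorm[OF bounded_clinear_imp_bounded_linear])

lemma bounded_clinear_onorm_nonneg: "0 \<le> onorm T"
  by (rule onorm_pos_le[OF bounded_clinear_imp_bounded_linear])

end

lemma bounded_clinear_id [simp]: "bounded_clinear (\<lambda>x. x)"
  by (rule bounded_clinearI[where K = 1]) auto

lemma bounded_clinear_compose:
  assumes S: "bounded_clinear S" and T: "bounded_clinear T"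
  shows "bounded_clinear (\<lambda>x. S (T x))"
proof -
  have "norm (S (T x)) \<le> (onorm S * onorm T) * norm x" for x
    using bounded_clinear_bound[OF S, of "T x"] bounded_clinear_bound[OF T, of x]
      bounded_clinear_onorm_nonneg[OF S]
    by (metis mult.assoc mult_left_mono order_trans)
  then show ?thesis
    by (intro bounded_clinearI) (simp_all add: S T bounded_clinear_add bounded_clinear_scaleC)
qed

lemma bounded_clinear_sum2:
  assumes S: "bounded_clinear S" and T: "bounded_clinear T"
  shows "bounded_clinear (\<lambda>x. S x + T x)"
proof -
  have "norm (S x + T x) \<le> (onorm S + onorm T) * norm x" for x
    using bounded_clinear_bound[OF S, of x] bounded_clinear_bound[OF T, of x]
      norm_triangle_ineq[of "S x" "T x"] by (simp add: distrib_right)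
  then show ?thesis
    by (intro bounded_clinearI)
      (simp_all add: S T bounded_clinear_add bounded_clinear_scaleC scaleC_add_right)
qed

lemma bounded_clinear_scaleC_left:
  assumes T: "bounded_clinear T"
  shows "bounded_clinear (\<lambda>x. a *\<^sub>C T x)"
proof -
  have "norm (a *\<^sub>C T x) \<le> (cmod a * onorm T) * norm x" for x
    using bounded_clinear_bound[OF T, of x] by (simp add: norm_scaleC mult.assoc mult_left_mono)
  then show ?thesis
    by (intro bounded_clinearI[where K = "cmod a * onorm T"])
      (simp_all add: T bounded_clinear_add bounded_clinear_scaleC scaleC_add_right scaleC_scaleC
        mult.commute[of a])
qed

lemma bounded_clinear_diff2:
  assumes S: "bounded_clinear S" and T: "bounded_clinear T"
  shows "bounded_clinear (\<lambda>x. S x - T x)"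
  using bounded_clinear_sum2[OF S bounded_clinear_scaleC_left[OF T, of "-1"]]
  by simp

text \<open>Polarization: norms of sums determine the real part, and replacing \<open>y\<close> by
  \<open>\<i> *\<^sub>C y\<close> recovers the imaginary part.\<close>

lemma isometry_cinner:
  assumes V: "isometry_op V"
  shows "cinner (V x) (V y) = cinner x y"
proof (rule complex_eqI)
  have bV: "bounded_clinear V" and nV: "\<And>x. norm (V x) = norm x"
    using V by (auto simp: isometry_op_def)
  have Re: "Re (cinner (V x) (V y)) = Re (cinner x y)" for x y
    using power2_norm_add[of "V x" "V y"] power2_norm_add[of x y]
    by (simp add: nV flip: bounded_clinear_add[OF bV])
  then show "Re (cinner (V x) (V y)) = Re (cinner x y)" .
  show "Im (cinner (V x) (V y)) = Im (cinner x y)"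
    unfolding Im_cinner by (simp add: Re flip: bounded_clinear_scaleC[OF bV])
qed

lemma invertible_opI:
  assumes "bounded_clinear A" "bounded_clinear B" "\<And>x. B (A x) = x" "\<And>x. A (B x) = x"
  shows "invertible_op A" "inv A = B"
proof -
  show eq: "inv A = B"
    using assms(3,4) by (intro inv_unique_comp) (auto simp: fun_eq_iff)
  have "bij A"
    using assms(3,4) by (intro o_bij[of B]) (auto simp: fun_eq_iff)
  then show "invertible_op A"
    using assms eq by (simp add: invertible_op_def)
qed

context
  fixes A :: "'a :: complex_inner \<Rightarrow> 'a"
  assumes A: "invertible_op A"
begin

lemma invertible_op_bounded_clinear: "bounded_clinear A"
  and invertible_op_bounded_clinear_inv: "bounded_clinear (inv A)"
  and invertible_op_inv_left: "inv A (A x) = x"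
  and invertible_op_inv_right: "A (inv A x) = x"
  using A by (auto simp: invertible_op_def bij_is_inj bij_is_surj surj_f_inv_f)

lemma invertible_op_inv_eq: "A y = x \<Longrightarrow> inv A x = y"
  using invertible_op_inv_left by blast

end

lemma invertible_op_id: "invertible_op (\<lambda>x. x)"
  by (rule invertible_opI(1)[of _ "\<lambda>x. x"]) auto

lemma invertible_op_compose:
  assumes A: "invertible_op A" and B: "invertible_op B"
  shows "invertible_op (\<lambda>x. A (B x))" "inv (\<lambda>x. A (B x)) = (\<lambda>x. inv B (inv A x))"
  by (rule invertible_opI[of _ "\<lambda>x. inv B (inv A x)"];
      simp add: A B bounded_clinear_compose invertible_op_bounded_clinear
      invertible_op_bounded_clinear_inv invertible_op_inv_left invertible_op_inv_right)+

lemma invertible_op_scaleC: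
  assumes A: "invertible_op A" and "a \<noteq> 0"
  shows "invertible_op (\<lambda>x. a *\<^sub>C A x)"
proof (rule invertible_opI(1)[of _ "\<lambda>x. inv A (inverse a *\<^sub>C x)"])
  show "bounded_clinear (\<lambda>x. inv A (inverse a *\<^sub>C x))"
    by (intro bounded_clinear_compose[OF invertible_op_bounded_clinear_inv[OF A]]
        bounded_clinear_scaleC_left bounded_clinear_id)
qed (use assms in \<open>simp_all add: bounded_clinear_scaleC_left invertible_op_bounded_clinear
    invertible_op_inv_left invertible_op_inv_right scaleC_scaleC\<close>)

text \<open>The equation \<open>A y - z y = x\<close> is the fixed point problem
  \<open>y = (A y - x) / z\<close>. Its right side contracts with factor \<open>1 / cmod z\<close>,
  so Banach's theorem gives bijectivity.\<close>

lemma contraction_minus_scaleC_invertible: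
  fixes A :: "'a :: chilbert_space \<Rightarrow> 'a"
  assumes A: "bounded_clinear A" and le: "\<And>x. norm (A x) \<le> norm x" and z: "1 < cmod z"
  shows "invertible_op (\<lambda>x. A x - z *\<^sub>C x)"
proof -
  let ?B = "\<lambda>x. A x - z *\<^sub>C x"
  have z0: "z \<noteq> 0" using z by auto
  have B: "bounded_clinear ?B"
    by (intro bounded_clinear_diff2 A bounded_clinear_scaleC_left bounded_clinear_id)
  have ex1: "\<exists>!y. ?B y = x" for x
  proof -
    define f where "f y = inverse z *\<^sub>C (A y - x)" for y
    have "dist (f y) (f y') \<le> cmod (inverse z) * dist y y'" for y y'
      using le[of "y - y'"] 
      by (simp add: f_def dist_norm norm_scaleC bounded_clinear_diff[OF A] mult_left_mono
          flip: scaleC_diff_right)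
    then have "\<exists>!y\<in>UNIV. f y = y"
      using z by (intro Banach_fix[where c = "cmod (inverse z)"])
        (auto simp: complete_UNIV norm_inverse inverse_less_1_iff)
    moreover have "f y = y \<longleftrightarrow> ?B y = x" for y
    proof -
      have "f y = y \<longleftrightarrow> z *\<^sub>C f y = z *\<^sub>C y"
        using z0 by (metis scaleC_scaleC scaleC_simps(2) left_inverse)
      also have "z *\<^sub>C f y = A y - x"
        using z0 by (simp add: f_def scaleC_scaleC)
      finally show ?thesis by (auto simp: algebra_simps)
    qed
    ultimately show ?thesis by simp
  qed
  then have bij: "bij ?B"
    by (simp add: bij_iff)
  have r: "?B (inv ?B x) = x" for x
    by (rule surj_f_inv_f[OF bij_is_surj[OF bij]])
  have i: "inv ?B x = y \<longleftrightarrow> x = ?B y" for x y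
    using bij_inv_eq_iff[OF bij, of y x] by metis
  \<comment> \<open>This lower bound is what makes the inverse bounded.\<close>
  have low: "(cmod z - 1) * norm y \<le> norm (?B y)" for y
    using norm_triangle_ineq2[of "z *\<^sub>C y" "A y"] le[of y]
    by (simp add: norm_scaleC norm_minus_commute left_diff_distrib)
  have "bounded_clinear (inv ?B)"
  proof (rule bounded_clinearI)
    show "inv ?B (x + y) = inv ?B x + inv ?B y" for x y
      unfolding i bounded_clinear_add[OF B] r ..
    show "inv ?B (a *\<^sub>C x) = a *\<^sub>C inv ?B x" for a x
      unfolding i bounded_clinear_scaleC[OF B] r ..
    show "norm (inv ?B x) \<le> inverse (cmod z - 1) * norm x" for x
      using low[of "inv ?B x"] z unfolding r by (simp add: field_simps)
  qed
  with B bij show ?thesis by (simp add: invertible_op_def)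
qed

section \<open>Adjoints\<close>

text \<open>The representing vector minimizes \<open>\<lambda>x. (norm x)\<^sup>2 - 2 * Re (f x)\<close>.\<close>

lemma riesz_representation:
  fixes f :: "'a :: chilbert_space \<Rightarrow> complex"
  assumes f: "bounded_clinear f"
  shows "\<exists>u. \<forall>x. f x = cinner x u"
proof -
  define \<phi> where "\<phi> x = (norm x)\<^sup>2 - 2 * Re (f x)" for x
  define m where "m = (INF x. \<phi> x)"
  have lower: "- (onorm f)\<^sup>2 \<le> \<phi> x" for x
  proof -
    have "Re (f x) \<le> onorm f * norm x"
      using bounded_clinear_bound[OF f, of x] complex_Re_le_cmod[of "f x"] by linarith
    moreover have "0 \<le> (norm x - onorm f)\<^sup>2" by simp
    ultimately show ?thesis by (simp add: \<phi>_def power2_diff algebra_simps)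
  qed
  have bdd: "bdd_below (range \<phi>)" using lower by (intro bdd_belowI2)
  have m: "m \<le> \<phi> x" for x unfolding m_def by (rule cINF_lower[OF bdd]) simp
  have half: "Re (cinner ((1/2) *\<^sub>R x) ((1/2) *\<^sub>R y)) = Re (cinner x y) / 4" for x y
    by (simp add: scaleR_scaleC cinner_scaleC_left cinner_scaleC_right)
  \<comment> \<open>Parallelogram law for \<open>\<phi>\<close>, whose linear part cancels. Since
    the midpoint has value at least \<open>m\<close>, near minimizers are close to each
    other.\<close>
  have para: "\<phi> x + \<phi> y = 2 * \<phi> ((1/2) *\<^sub>R (x + y)) + (norm (x - y))\<^sup>2 / 2" for x y
    by (simp add: \<phi>_def bounded_clinear_scaleR[OF f] bounded_clinear_add[OF f] power_divide half
        power2_norm_add power2_norm_diff field_simps del: scaleR_add_right scaleR_right_distrib)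
  have "\<exists>x. \<phi> x < m + 1 / Suc n" for n
    using cInf_lessD[of "range \<phi>" "m + 1 / Suc n"] by (auto simp: m_def)
  then obtain X where X: "\<And>n. \<phi> (X n) < m + 1 / Suc n" by metis
  have close: "(norm (X i - X j))\<^sup>2 \<le> 4 / Suc n" if "i \<ge> n" "j \<ge> n" for i j n
  proof -
    have "1 / Suc i \<le> 1 / Suc n" "1 / Suc j \<le> 1 / Suc n"
      using that by (auto simp: frac_le)
    then show ?thesis
      using para[of "X i" "X j"] m[of "(1/2) *\<^sub>R (X i + X j)"] X[of i] X[of j] by simp
  qed
  have "Cauchy X"
    unfolding Cauchy_def
  proof (intro allI impI)
    fix e :: real assume e: "e > 0"
    then obtain n :: nat where n: "4 / e\<^sup>2 < n" using reals_Archimedean2 by blast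
    then have n': "4 / Suc n < e\<^sup>2" using e zero_less_power[OF e, of 2]
    by (simp add: field_simps, linarith)
    show "\<exists>M. \<forall>i\<ge>M. \<forall>j\<ge>M. dist (X i) (X j) < e"
    proof (intro exI allI impI)
      fix i j assume "i \<ge> n" "j \<ge> n"
      from close[OF this] n' have "(norm (X i - X j))\<^sup>2 < e\<^sup>2" by linarith
      then show "dist (X i) (X j) < e" using e by (simp add: dist_norm power2_less_imp_less)
    qed
  qed
  then obtain u where u: "X \<longlonglongrightarrow> u" by (auto simp: Cauchy_convergent_iff convergent_def)
  have "(\<lambda>n. \<phi> (X n)) \<longlonglongrightarrow> \<phi> u"
    unfolding \<phi>_def
    by (intro tendsto_intros u bounded_linear.tendsto[OF bounded_clinear_imp_bounded_linear[OF f]])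
  moreover have "(\<lambda>n. m + 1 / Suc n) \<longlonglongrightarrow> m + 0"
    using LIMSEQ_inverse_real_of_nat by (intro tendsto_add) (simp_all add: inverse_eq_divide)
  ultimately have "\<phi> u \<le> m"
    using X by (intro LIMSEQ_le[of "\<lambda>n. \<phi> (X n)" "\<phi> u" "\<lambda>n. m + 1 / Suc n"]) (auto intro: less_imp_le)
  then have min: "\<phi> u \<le> \<phi> x" for x using m[of x] by linarith
  have Re: "Re (cinner u v) = Re (f v)" for v
  proof -
    \<comment> \<open>First variation: along \<open>u + t v\<close> the increment of
      \<open>\<phi>\<close> is a quadratic in \<open>t\<close> with linear coefficient
      \<open>2 * d\<close>. It is nonnegative for all \<open>t\<close>, which forces
      \<open>d = 0\<close>.\<close>
    define d where "d = Re (cinner u v) - Re (f v)"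
    have q: "0 \<le> t\<^sup>2 * (norm v)\<^sup>2 + 2 * t * d" for t
    proof -
      have "\<phi> (u + t *\<^sub>R v) = \<phi> u + t\<^sup>2 * (norm v)\<^sup>2 + 2 * t * d"
        by (simp add: \<phi>_def d_def power2_norm_add bounded_clinear_add[OF f]
            bounded_clinear_scaleR[OF f] power_mult_distrib scaleR_scaleC[of t v]
            cinner_scaleC_right algebra_simps norm_scaleC bounded_clinear_scaleC[OF f] scaleC_complex_def)
      then show ?thesis using min[of "u + t *\<^sub>R v"] by linarith
    qed
    have "d = 0"
    proof (rule ccontr)
      assume "d \<noteq> 0"
      \<comment> \<open>The added 1 keeps \<open>c\<close> positive for \<open>v = 0\<close>; the
        \<open>t\<close> chosen next minimizes the majorant \<open>c t^2 + 2 d t\<close>.\<close>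
      define c where "c = (norm v)\<^sup>2 + 1"
      define t where "t = - d / c"
      have p: "c > 0" unfolding c_def by (rule add_nonneg_pos) auto
      have "t\<^sup>2 * (norm v)\<^sup>2 + 2 * t * d \<le> t\<^sup>2 * c + 2 * t * d"
        by (simp add: c_def algebra_simps)
      also have "\<dots> = - (d\<^sup>2 / c)"
        using p by (simp add: t_def power2_eq_square field_simps)
      also have "\<dots> < 0" using p \<open>d \<noteq> 0\<close> by simp
      finally show False using q[of t] by linarith
    qed
    then show ?thesis by (simp add: d_def)
  qed
  have "f x = cinner x u" for x
  proof -
    have "cinner u (\<i> *\<^sub>C x) = - \<i> * cinner u x" "f (\<i> *\<^sub>C x) = \<i> * f x"
      by (simp_all add: cinner_scaleC_right bounded_clinear_scaleC[OF f] scaleC_complex_def)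
    then have "Im (cinner u x) = - Im (f x)"
      using Re[of "\<i> *\<^sub>C x"] by simp
    then show ?thesis
      using Re[of x] cinner_commute[of x u] by (simp add: complex_eq_iff)
  qed
  then show ?thesis by blast
qed

text \<open>Riesz representation of \<open>x \<mapsto> cinner (T x) y\<close> yields
  \<open>S y\<close>. Linearity comes from uniqueness of the representing vector, the bound from
  testing with \<open>x = S y\<close>.\<close>

lemma adjoint_exists:
  fixes T :: "'a :: chilbert_space \<Rightarrow> 'b :: complex_inner"
  assumes T: "bounded_clinear T"
  obtains S where "bounded_clinear S" "\<And>x y. cinner (T x) y = cinner x (S y)"
proof -
  have "\<exists>u. \<forall>x. cinner (T x) y = cinner x u" for y
  proof (rule riesz_representation, rule bounded_clinearI)
    show "norm (cinner (T x) y) \<le> (onorm T * norm y) * norm x" for x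
      using cauchy_schwarz[of "T x" y] mult_right_mono[OF bounded_clinear_bound[OF T, of x] norm_ge_zero[of y]]
      by (simp add: mult_ac)
  qed (simp_all add: bounded_clinear_add[OF T] bounded_clinear_scaleC[OF T] cinner_add_left
      cinner_scaleC_left scaleC_complex_def)
  then obtain S where S: "\<And>x y. cinner (T x) y = cinner x (S y)" by metis
  have "bounded_clinear S"
  proof (rule bounded_clinearI)
    show "S (x + y) = S x + S y" for x y
      by (rule cinner_ext) (simp add: cinner_add_right flip: S)
    show "S (a *\<^sub>C x) = a *\<^sub>C S x" for a x
      by (rule cinner_ext) (simp add: cinner_scaleC_right flip: S)
    show "norm (S y) \<le> onorm T * norm y" for y
    proof (cases "S y = 0")
      case False
      have "(norm (S y))\<^sup>2 \<le> cmod (cinner (T (S y)) y)"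
        by (simp add: S cinner_self norm_power)
      also have "\<dots> \<le> norm (T (S y)) * norm y" by (rule cauchy_schwarz)
      also have "\<dots> \<le> onorm T * norm (S y) * norm y"
        by (intro mult_right_mono bounded_clinear_bound[OF T]) simp
      finally show ?thesis using False by (simp add: power2_eq_square mult_ac)
    qed (simp add: bounded_clinear_onorm_nonneg[OF T])
  qed
  with S that show ?thesis by blast
qed

lemma adjoint_flip:
  assumes "\<And>x y. cinner (T x) y = cinner x (S y)"
  shows "cinner (S x) y = cinner x (T y)"
  unfolding cinner_commute[of "S x" y] cinner_commute[of x "T y"] by (simp add: assms)

lemma adjoint_contraction:
  assumes adj: "\<And>x y. cinner (T x) y = cinner x (S y)" and le: "\<And>x. norm (T x) \<le> norm x"
  shows "norm (S y) \<le> norm y"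
proof (cases "S y = 0")
  case False
  have "(norm (S y))\<^sup>2 \<le> cmod (cinner (T (S y)) y)"
    by (simp add: adj cinner_self norm_power)
  also have "\<dots> \<le> norm (T (S y)) * norm y" by (rule cauchy_schwarz)
  also have "\<dots> \<le> norm (S y) * norm y"
    by (intro mult_right_mono le) simp
  finally show ?thesis using False by (simp add: power2_eq_square)
qed simp

text \<open>Adjoints are unique, so any operator with the adjoint property evaluates the definite
  description.\<close>

lemma cadjoint_eqI:
  assumes "\<And>x y. cinner (T x) y = cinner x (S y)"
  shows "cadjoint T = S"
  unfolding cadjoint_def
proof (rule the_equality)
  show "R = S" if "\<forall>x y. cinner (T x) y = cinner x (R y)" for R
    by (rule ext, rule cinner_ext) (simp flip: that assms)
qed (use assms in blast)

lemma cinner_cadjoint: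
  fixes T :: "'a :: chilbert_space \<Rightarrow> 'a"
  assumes "bounded_clinear T"
  shows "cinner (T x) y = cinner x (cadjoint T y)"
  using adjoint_exists[OF assms] cadjoint_eqI by metis

text \<open>Two candidates differ by a vector of \<open>M\<close> that is orthogonal to
  itself.\<close>

lemma orth_proj_eqI:
  assumes M: "\<And>x y. x \<in> M \<Longrightarrow> y \<in> M \<Longrightarrow> x - y \<in> M"
    and "y \<in> M" "\<And>m. m \<in> M \<Longrightarrow> cinner (x - y) m = 0"
  shows "orth_proj M x = y"
  unfolding orth_proj_def
proof (rule the_equality)
  fix y' assume y': "y' \<in> M \<and> (\<forall>m\<in>M. cinner (x - y') m = 0)"
  then have "y - y' \<in> M" using M assms(2) by blast
  then have "cinner (x - y') (y - y') - cinner (x - y) (y - y') = 0" using y' assms(3) by simp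
  then show "y' = y" by (simp add: cinner_self flip: cinner_diff_left)
qed (use assms in blast)

lemma range_diff:
  assumes "bounded_clinear V" "x \<in> range V" "y \<in> range V"
  shows "x - y \<in> range V"
  using assms(2,3) by (auto simp flip: bounded_clinear_diff[OF assms(1)])

text \<open>The projection is \<open>V\<close> composed with its adjoint, and the adjoint of an
  isometry is a contraction.\<close>

lemma orth_proj_range_norm_le:
  fixes V :: "'h :: chilbert_space \<Rightarrow> 'k :: chilbert_space"
  assumes V: "isometry_op V"
  shows "norm (orth_proj (range V) x) \<le> norm x"
proof -
  have bV: "bounded_clinear V" and nV: "\<And>x. norm (V x) = norm x"
    using V by (auto simp: isometry_op_def)
  obtain S where S: "\<And>x y. cinner (V x) y = cinner x (S y)"
    using adjoint_exists[OF bV] by metis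
  have "cinner (V h) (V (S x)) = cinner (V h) x" for h
    by (metis S isometry_cinner[OF V])
  then have "cinner (x - V (S x)) (V h) = 0" for h
    using cinner_commute[of "x - V (S x)" "V h"] by (simp add: cinner_diff_right)
  then have "orth_proj (range V) x = V (S x)"
    by (intro orth_proj_eqI range_diff[OF bV]) auto
  moreover have "norm (S x) \<le> norm x"
    by (rule adjoint_contraction[of V]) (simp_all add: S nV)
  ultimately show ?thesis by (simp add: nV)
qed

section \<open>Normal operators with spectrum in the closed unit disc\<close>

lemma invertible_op_lower_bound:
  assumes A: "invertible_op A"
  obtains c where "c > 0" "\<And>y. c * norm y \<le> norm (A y)"
proof
  \<comment> \<open>The added 1 keeps \<open>K\<close> positive when \<open>inv A\<close> is zero,
    as on the trivial space.\<close>
  define K where "K = onorm (inv A) + 1"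
  have K: "K > 0"
    using bounded_clinear_onorm_nonneg[OF invertible_op_bounded_clinear_inv[OF A]] by (simp add: K_def)
  show "inverse K > 0" using K by simp
  show "inverse K * norm y \<le> norm (A y)" for y
  proof -
    have "norm y \<le> onorm (inv A) * norm (A y)"
      using bounded_clinear_bound[OF invertible_op_bounded_clinear_inv[OF A], of "A y"]
      by (simp add: invertible_op_inv_left[OF A])
    also have "\<dots> \<le> K * norm (A y)" by (simp add: K_def distrib_right)
    finally show ?thesis using K by (simp add: field_simps)
  qed
qed

text \<open>Compactness of the disc: otherwise some \<open>L n\<close> and \<open>Y n\<close>
  violate the bound with constant \<open>1 / Suc n\<close>. A subsequence of \<open>L\<close>
  converges to some \<open>l\<close>, and the lower bound available at \<open>l\<close> is
  contradicted in the limit.\<close>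

lemma resolvent_uniform_lower_bound:
  assumes M: "bounded_clinear M"
    and inv: "\<And>l. cmod l \<le> s \<Longrightarrow> invertible_op (\<lambda>x. x - l *\<^sub>C M x)"
  obtains c where "c > 0" "\<And>l y. cmod l \<le> s \<Longrightarrow> c * norm y \<le> norm (y - l *\<^sub>C M y)"
proof (rule ccontr)
  assume neg: "\<not> thesis"
  have "\<exists>l y. cmod l \<le> s \<and> norm (y - l *\<^sub>C M y) < 1 / Suc n * norm y" for n
  proof (rule ccontr)
    assume "\<not> ?thesis"
    then have "cmod l \<le> s \<Longrightarrow> 1 / Suc n * norm y \<le> norm (y - l *\<^sub>C M y)" for l y
      by (meson not_le)
    from that[OF _ this] neg show False by simp
  qed
  then obtain L Y where L: "\<And>n. cmod (L n) \<le> s"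
    and Y: "\<And>n :: nat. norm (Y n - L n *\<^sub>C M (Y n)) < 1 / Suc n * norm (Y n)" by metis
  from L have "\<forall>n. L n \<in> cball 0 s" by simp
  then obtain l \<phi> where l: "cmod l \<le> s" and \<phi>: "strict_mono \<phi>" and lim: "(L \<circ> \<phi>) \<longlonglongrightarrow> l"
    using compact_cball[of "0 :: complex" s] unfolding compact_def by (metis mem_cball_0)
  obtain c where c: "c > 0" "\<And>y. c * norm y \<le> norm (y - l *\<^sub>C M y)"
    using invertible_op_lower_bound[OF inv[OF l]] by metis
  have "c \<le> 1 / Suc (\<phi> n) + cmod (L (\<phi> n) - l) * onorm M" for n
  proof -
    let ?y = "Y (\<phi> n)" and ?l = "L (\<phi> n)"
    have y: "norm ?y > 0"
      using Y[of "\<phi> n"]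
      by (metis less_irrefl mult_zero_right norm_eq_zero norm_not_less_zero zero_less_norm_iff)
    have "?y - l *\<^sub>C M ?y = (?y - ?l *\<^sub>C M ?y) + (?l - l) *\<^sub>C M ?y"
      using scaleC_add_left[of "?l - l" l "M ?y"] by simp
    then have "norm (?y - l *\<^sub>C M ?y) \<le> norm (?y - ?l *\<^sub>C M ?y) + cmod (?l - l) * norm (M ?y)"
      using norm_triangle_ineq by (metis norm_scaleC)
    also have "\<dots> \<le> 1 / Suc (\<phi> n) * norm ?y + cmod (?l - l) * (onorm M * norm ?y)"
      by (intro add_mono mult_left_mono bounded_clinear_bound[OF M] less_imp_le[OF Y]) simp
    finally have "c * norm ?y \<le> (1 / Suc (\<phi> n) + cmod (?l - l) * onorm M) * norm ?y"
      using c(2)[of ?y] by (simp add: algebra_simps)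
    then show ?thesis using y by (simp only: mult_le_cancel_right_pos)
  qed
  moreover have "(\<lambda>n. 1 / Suc (\<phi> n) + cmod (L (\<phi> n) - l) * onorm M) \<longlonglongrightarrow> 0 + 0 * onorm M"
  proof (intro tendsto_add tendsto_mult tendsto_const)
    show "(\<lambda>n. 1 / Suc (\<phi> n)) \<longlonglongrightarrow> 0"
      using LIMSEQ_subseq_LIMSEQ[OF LIMSEQ_inverse_real_of_nat \<phi>]
      by (simp add: o_def inverse_eq_divide)
    show "(\<lambda>n. cmod (L (\<phi> n) - l)) \<longlonglongrightarrow> 0"
      using lim by (intro tendsto_norm_zero) (simp add: LIM_zero_iff o_def)
  qed
  ultimately have "c \<le> 0 + 0 * onorm M" by (intro LIMSEQ_le_const) auto
  with c(1) show False by simp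
qed

text \<open>Cauchy's estimate on the circle of radius \<open>s\<close> for \<open>l \<mapsto> cinner (inverse (1 - l M) x) (M\<^sup>n x)\<close>.\<close>

lemma resolvent_power_bound:
  fixes M :: "'a :: chilbert_space \<Rightarrow> 'a"
  assumes M: "bounded_clinear M" and s: "0 < s"
    and inv: "\<And>l. cmod l \<le> s \<Longrightarrow> invertible_op (\<lambda>x. x - l *\<^sub>C M x)"
  obtains C where "\<And>n x. s ^ n * norm ((M ^^ n) x) \<le> C * norm x"
proof -
  obtain c where c: "c > 0" "\<And>l y. cmod l \<le> s \<Longrightarrow> c * norm y \<le> norm (y - l *\<^sub>C M y)"
    using resolvent_uniform_lower_bound[OF M inv] by metis
  define R where "R l = inv (\<lambda>x. x - l *\<^sub>C M x)" for l
  define K where "K = onorm M"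
  have K: "0 \<le> K" unfolding K_def by (rule bounded_clinear_onorm_nonneg[OF M])
  have bR: "bounded_clinear (R l)" if "cmod l \<le> s" for l
    unfolding R_def by (rule invertible_op_bounded_clinear_inv[OF inv[OF that]])
  have R_right: "R l x - l *\<^sub>C M (R l x) = x" if "cmod l \<le> s" for l x
    unfolding R_def by (rule invertible_op_inv_right[OF inv[OF that]])
  have R_eq: "R l (y - l *\<^sub>C M y) = y" if "cmod l \<le> s" for l y
    unfolding R_def by (rule invertible_op_inv_left[OF inv[OF that]])
  have R_le: "norm (R l x) \<le> norm x / c" if "cmod l \<le> s" for l x
    using c(2)[OF that, of "R l x"] R_right[OF that, of x] c(1) by (simp add: field_simps)
  \<comment> \<open>Resolvent identity. It gives Lipschitz continuity of
    \<open>l \<mapsto> cinner (R l x) y\<close> and, after division by \<open>m - l\<close>, its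
    complex derivative.\<close>
  have R_diff: "R m x - R l x = (m - l) *\<^sub>C R m (M (R l x))" if "cmod l \<le> s" "cmod m \<le> s" for l m x
  proof -
    have "R l x - m *\<^sub>C M (R l x) = x - (m - l) *\<^sub>C M (R l x)"
      using R_right[OF that(1), of x] scaleC_add_left[of "m - l" l "M (R l x)"]
      by (simp add: algebra_simps)
    then have "R l x = R m (x - (m - l) *\<^sub>C M (R l x))"
      using R_eq[OF that(2)] by metis
    also have "\<dots> = R m x - (m - l) *\<^sub>C R m (M (R l x))"
      by (simp add: bounded_clinear_diff[OF bR[OF that(2)]] bounded_clinear_scaleC[OF bR[OF that(2)]])
    finally show ?thesis by (simp add: algebra_simps)
  qed
  have f_diff: "cinner (R m x) y - cinner (R l x) y = (m - l) * cinner (R m (M (R l x))) y"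
    if "cmod l \<le> s" "cmod m \<le> s" for l m x y
    using R_diff[OF that] by (simp add: cinner_scaleC_left flip: cinner_diff_left)
  have f_le: "cmod (cinner (R l x) y) \<le> norm x * norm y / c" if "cmod l \<le> s" for l x y
    using order_trans[OF cauchy_schwarz[of "R l x" y] mult_right_mono[OF R_le[OF that, of x] norm_ge_zero[of y]]]
    by simp
  have cont: "continuous_on (cball 0 s) (\<lambda>l. cinner (R l x) y)" for x y
  proof (rule Lipschitz.lipschitz_on_continuous_on, rule lipschitz_onI)
    show "dist (cinner (R m x) y) (cinner (R l x) y) \<le> (K * (norm x / c) * norm y / c) * dist m l"
      if "m \<in> cball 0 s" "l \<in> cball 0 s" for m l
    proof -
      have ml: "cmod l \<le> s" "cmod m \<le> s" using that by auto
      have "cmod (cinner (R m (M (R l x))) y) \<le> norm (M (R l x)) * norm y / c"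
        by (rule f_le[OF ml(2)])
      also have "\<dots> \<le> K * (norm x / c) * norm y / c"
        using order_trans[OF bounded_clinear_bound[OF M] mult_left_mono[OF R_le[OF ml(1)]], of x] c(1) K
        by (intro divide_right_mono mult_right_mono) (auto simp: K_def)
      finally have "cmod (m - l) * cmod (cinner (R m (M (R l x))) y)
          \<le> cmod (m - l) * (K * (norm x / c) * norm y / c)"
        by (rule mult_left_mono) simp
      then show ?thesis
        unfolding dist_norm f_diff[OF ml] norm_mult by (simp only: mult.commute)
    qed
    show "0 \<le> K * (norm x / c) * norm y / c" using K c(1) by simp
  qed
  have hol: "(\<lambda>l. cinner (R l x) y) holomorphic_on ball 0 s" for x y
  proof (rule holomorphic_onI)
    fix l :: complex assume l: "l \<in> ball 0 s"
    let ?D = "\<lambda>m. cinner (R m (M (R l x))) y"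
    have near: "\<forall>\<^sub>F m in at l. m \<in> ball 0 s - {l}"
      by (rule eventually_at_in_open[OF open_ball l])
    have "continuous_on (ball 0 s) ?D"
      by (rule continuous_on_subset[OF cont]) auto
    then have "?D \<midarrow>l\<rightarrow> ?D l"
      using l by (simp add: continuous_on_eq_continuous_at isCont_def)
    moreover have "\<forall>\<^sub>F m in at l. ?D m = (cinner (R m x) y - cinner (R l x) y) / (m - l)"
      using near by eventually_elim (use l in \<open>auto simp: f_diff\<close>)
    ultimately have "((\<lambda>l. cinner (R l x) y) has_field_derivative ?D l) (at l)"
      unfolding has_field_derivative_iff by (rule Lim_transform_eventually)
    then show "(\<lambda>l. cinner (R l x) y) field_differentiable at l within ball 0 s"
      using field_differentiable_at_within field_differentiable_def by blast
  qed
  \<comment> \<open>Finite Neumann series with its exact remainder.\<close>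
  have expand: "cinner (R l x) y
      = (\<Sum>k<n. cinner ((M ^^ k) x) y * l ^ k) + l ^ n * cinner (R l ((M ^^ n) x)) y"
    if "cmod l \<le> s" for l x y n
  proof (induction n)
    case (Suc n)
    have "R l z = z + l *\<^sub>C R l (M z)" for z
      using R_eq[OF that, of z]
      by (simp add: bounded_clinear_diff[OF bR[OF that]] bounded_clinear_scaleC[OF bR[OF that]] diff_eq_eq)
    from this[of "(M ^^ n) x"] show ?case
      unfolding Suc by (simp add: cinner_add_left cinner_scaleC_left algebra_simps)
  qed simp
  have pow_le: "norm ((M ^^ n) x) \<le> K ^ n * norm x" for n x
  proof (induction n)
    case (Suc n)
    then show ?case
      using order_trans[OF bounded_clinear_bound[OF M] mult_left_mono[OF Suc]]
        bounded_clinear_onorm_nonneg[OF M] by (simp add: K_def mult.assoc)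
  qed simp
  have "(\<lambda>l. cinner (R l x) y) has_fps_expansion Abs_fps (\<lambda>n. cinner ((M ^^ n) x) y)" for x y
  proof (rule has_fps_expansionI)
    \<comment> \<open>On this smaller disc \<open>cmod l * K < 1\<close>, so the remainder tends to
      0. A neighbourhood of 0 suffices to identify the Taylor coefficients; Cauchy's inequality then
      uses the full radius \<open>s\<close>.\<close>
    have "min s (1 / (K + 1)) > 0" using s K by simp
    then have "\<forall>\<^sub>F l in nhds 0. l \<in> ball 0 (min s (1 / (K + 1)))"
      by (intro eventually_nhds_in_open) auto
    then show "\<forall>\<^sub>F l in nhds 0.
        (\<lambda>n. fps_nth (Abs_fps (\<lambda>n. cinner ((M ^^ n) x) y)) n * l ^ n) sums cinner (R l x) y"
    proof eventually_elim
      case (elim l)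
      then have l: "cmod l \<le> s" "cmod l * (K + 1) < 1" using K by (auto simp: field_simps)
      have "cmod l * K \<le> cmod l * (K + 1)" by (rule mult_left_mono) auto
      with l(2) have q: "cmod l * K < 1" by linarith
      have "(\<lambda>n. l ^ n * cinner (R l ((M ^^ n) x)) y) \<longlonglongrightarrow> 0"
      proof (rule Lim_null_comparison)
        show "\<forall>\<^sub>F n in sequentially. norm (l ^ n * cinner (R l ((M ^^ n) x)) y)
            \<le> (cmod l * K) ^ n * (norm x * norm y / c)"
        proof (rule always_eventually, rule allI)
          fix n
          have "cmod (cinner (R l ((M ^^ n) x)) y) \<le> norm ((M ^^ n) x) * norm y / c"
            by (rule f_le[OF l(1)])
          also have "\<dots> \<le> K ^ n * norm x * norm y / c"
            using c(1) pow_le by (intro divide_right_mono mult_right_mono) auto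
          finally have "cmod l ^ n * cmod (cinner (R l ((M ^^ n) x)) y)
              \<le> cmod l ^ n * (K ^ n * norm x * norm y / c)"
            by (rule mult_left_mono) simp
          then show "norm (l ^ n * cinner (R l ((M ^^ n) x)) y) \<le> (cmod l * K) ^ n * (norm x * norm y / c)"
            by (simp add: norm_mult norm_power power_mult_distrib mult_ac)
        qed
        have "(\<lambda>n. (cmod l * K) ^ n) \<longlonglongrightarrow> 0"
          using q K by (intro LIMSEQ_power_zero) auto
        then show "(\<lambda>n. (cmod l * K) ^ n * (norm x * norm y / c)) \<longlonglongrightarrow> 0"
          by (rule tendsto_mult_left_zero)
      qed
      then have "(\<lambda>n. cinner (R l x) y - l ^ n * cinner (R l ((M ^^ n) x)) y) \<longlonglongrightarrow> cinner (R l x) y - 0"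
        by (intro tendsto_intros)
      moreover have "cinner (R l x) y - l ^ n * cinner (R l ((M ^^ n) x)) y
          = (\<Sum>k<n. cinner ((M ^^ k) x) y * l ^ k)" for n
        using expand[OF l(1), of x y n] by simp
      ultimately show ?case by (simp add: sums_def)
    qed
  qed
  from fps_nth_fps_expansion[OF this]
  have coeff: "(deriv ^^ n) (\<lambda>l. cinner (R l x) y) 0 = fact n * cinner ((M ^^ n) x) y" for n x y
    by (simp add: field_simps)
  have "s ^ n * norm ((M ^^ n) x) \<le> inverse c * norm x" for n x
  proof (cases "(M ^^ n) x = 0")
    case False
    \<comment> \<open>Pairing with \<open>(M ^^ n) x\<close> itself turns the coefficient into a
      squared norm, and one factor of it cancels.\<close>
    let ?y = "(M ^^ n) x"
    have "norm ((deriv ^^ n) (\<lambda>l. cinner (R l x) ?y) 0) \<le> fact n * (norm x * norm ?y / c) / s ^ n"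
      by (rule Cauchy_inequality[OF hol cont s]) (simp add: f_le)
    then have "fact n * (norm ?y)\<^sup>2 \<le> fact n * (norm x * norm ?y / c / s ^ n)"
      unfolding coeff by (simp add: norm_mult cinner_self norm_power)
    then have "(norm ?y)\<^sup>2 \<le> norm x * norm ?y / c / s ^ n"
      by (rule mult_left_le_imp_le) simp
    then show ?thesis using False s c(1) by (simp add: power2_eq_square field_simps)
  qed (use c(1) in simp)
  with that show ?thesis by blast
qed

text \<open>The hypothesis \<open>para\<close> makes \<open>norm (M ((M ^^ n) x)) / norm ((M ^^ n) x)\<close> increasing in \<open>n\<close>. It holds
  for normal operators and passes to the inverse.\<close>

lemma paranormal_contraction:
  fixes M :: "'a :: chilbert_space \<Rightarrow> 'a"
  assumes M: "bounded_clinear M"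
    and para: "\<And>x. (norm (M x))\<^sup>2 \<le> norm (M (M x)) * norm x"
    and inv: "\<And>l. cmod l < 1 \<Longrightarrow> invertible_op (\<lambda>x. x - l *\<^sub>C M x)"
  shows "norm (M x) \<le> norm x"
proof (rule ccontr)
  assume gt: "\<not> norm (M x) \<le> norm x"
  then have x: "norm x > 0" using bounded_clinear_0[OF M] by auto
  define q where "q = norm (M x) / norm x"
  have q: "q > 1" using gt x by (simp add: q_def)
  \<comment> \<open>Both claims go into one induction: the ratio bound at \<open>n\<close> yields
    the growth at \<open>n + 1\<close>, and \<open>para\<close> carries the ratio bound
    over.\<close>
  have grow: "q ^ n * norm x \<le> norm ((M ^^ n) x) \<and> q * norm ((M ^^ n) x) \<le> norm (M ((M ^^ n) x))" for n
  proof (induction n)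
    case 0
    then show ?case using x by (simp add: q_def)
  next
    case (Suc n)
    let ?a = "norm ((M ^^ n) x)" and ?b = "norm (M ((M ^^ n) x))" and ?c = "norm (M (M ((M ^^ n) x)))"
    have "q ^ n * norm x > 0" using x q by simp
    then have a: "?a > 0" using Suc by linarith
    have "q * ?b * ?a = (q * ?a) * ?b" by simp
    also have "\<dots> \<le> ?b * ?b" by (rule mult_right_mono) (use Suc in auto)
    also have "\<dots> \<le> ?c * ?a" using para[of "(M ^^ n) x"] by (simp add: power2_eq_square)
    finally have "q * ?b \<le> ?c" using a by simp
    moreover have "q * (q ^ n * norm x) \<le> q * ?a"
      by (rule mult_left_mono) (use Suc q in auto)
    ultimately show ?case using Suc by simp
  qed
  have "1 / q < 1" using q by simp
  \<comment> \<open>The resolvent exists on the disc of radius \<open>s < 1\<close>, which bounds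
    \<open>(s * q) ^ n\<close>, although \<open>1 / q < s\<close> gives
    \<open>s * q > 1\<close>.\<close>
  then obtain s where s: "1 / q < s" "s < 1" using dense by blast
  then have s0: "s > 0" using q by (meson less_trans zero_less_divide_1_iff zero_less_one)
  obtain C where C: "\<And>n x. s ^ n * norm ((M ^^ n) x) \<le> C * norm x"
    using resolvent_power_bound[OF M s0 inv] s(2) by (metis le_less_trans)
  have "(s * q) ^ n \<le> C" for n
  proof -
    have "(s * q) ^ n * norm x = s ^ n * (q ^ n * norm x)" by (simp add: power_mult_distrib)
    also have "\<dots> \<le> s ^ n * norm ((M ^^ n) x)" using grow s0 by (intro mult_left_mono) auto
    also have "\<dots> \<le> C * norm x" by (rule C)
    finally show ?thesis using x by simp
  qed
  moreover have "s * q > 1" using s q by (simp add: field_simps)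
  ultimately show False using real_arch_pow[of "s * q" C] by (metis not_less)
qed

text \<open>By normality \<open>cadjoint N y\<close> and \<open>N y\<close> have equal norms, so
  Cauchy-Schwarz for \<open>cinner x (cadjoint N (N x))\<close> gives the inequality.\<close>

lemma normal_op_paranormal:
  fixes N :: "'a :: chilbert_space \<Rightarrow> 'a"
  assumes "normal_op N"
  shows "(norm (N x))\<^sup>2 \<le> norm (N (N x)) * norm x"
proof -
  have N: "bounded_clinear N" and comm: "\<And>x. cadjoint N (N x) = N (cadjoint N x)"
    using assms by (auto simp: normal_op_def fun_eq_iff)
  note adj = cinner_cadjoint[OF N]
  have "(norm (N y))\<^sup>2 = (norm (cadjoint N y))\<^sup>2" for y
  proof -
    have "cinner (N y) (N y) = cinner y (N (cadjoint N y))" by (simp add: adj comm)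
    also have "\<dots> = cnj (cinner (cadjoint N y) (cadjoint N y))"
      using cinner_commute[of y "N (cadjoint N y)"] adj by simp
    finally show ?thesis by (simp add: cinner_self flip: of_real_power)
  qed
  then have eq: "norm (cadjoint N y) = norm (N y)" for y
    by (metis norm_ge_zero power2_eq_iff_nonneg)
  have "(norm (N x))\<^sup>2 = cmod (cinner x (cadjoint N (N x)))"
    by (simp add: cinner_self norm_power flip: adj)
  also have "\<dots> \<le> norm x * norm (cadjoint N (N x))" by (rule cauchy_schwarz)
  finally show ?thesis by (simp add: eq mult.commute)
qed

text \<open>\<open>paranormal_contraction\<close> applies to \<open>N\<close> and to
  \<open>r N^-1\<close>, by \<open>1 - l N = - l (N - 1/l)\<close> and
  \<open>1 - l r N^-1 = (N - l r) N^-1\<close>: for \<open>cmod l < 1\<close> the points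
  \<open>1/l\<close> and \<open>l r\<close> lie off both circles.\<close>

lemma annulus_unitary_norm_bounds:
  fixes N :: "'k :: chilbert_space \<Rightarrow> 'k"
  assumes r: "0 < r" "r < 1" and N: "annulus_unitary r N"
  shows "norm (N x) \<le> norm x" "invertible_op N" "r * norm (inv N x) \<le> norm x"
proof -
  have normal: "normal_op N" and bN: "bounded_clinear N"
    and inv_shift: "\<And>z. cmod z \<noteq> 1 \<Longrightarrow> cmod z \<noteq> r \<Longrightarrow> invertible_op (\<lambda>x. N x - z *\<^sub>C x)"
    using N by (auto simp: annulus_unitary_def normal_op_def spectrum_def)
  note para = normal_op_paranormal[OF normal]
  show invN: "invertible_op N" using inv_shift[of 0] r by simp
  show "norm (N x) \<le> norm x"
  proof (rule paranormal_contraction[OF bN para])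
    fix l :: complex assume l: "cmod l < 1"
    show "invertible_op (\<lambda>x. x - l *\<^sub>C N x)"
    proof (cases "l = 0")
      case False
      then have "1 < cmod (1 / l)" using l by (simp add: norm_divide)
      then have "invertible_op (\<lambda>x. N x - (1 / l) *\<^sub>C x)" using r by (intro inv_shift) auto
      then have "invertible_op (\<lambda>x. (- l) *\<^sub>C (N x - (1 / l) *\<^sub>C x))"
        by (rule invertible_op_scaleC) (use False in simp)
      moreover have "(- l) *\<^sub>C (N x - (1 / l) *\<^sub>C x) = x - l *\<^sub>C N x" for x
        using False by (simp add: scaleC_diff_right scaleC_scaleC)
      ultimately show ?thesis by simp
    qed (simp add: invertible_op_id)
  qed
  let ?M = "\<lambda>x. complex_of_real r *\<^sub>C inv N x"
  have bI: "bounded_clinear (inv N)" by (rule invertible_op_bounded_clinear_inv[OF invN])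
  have "norm (?M x) \<le> norm x"
  proof (rule paranormal_contraction)
    show "bounded_clinear ?M" by (intro bounded_clinear_scaleC_left bI)
    \<comment> \<open>Paranormality of \<open>N\<close> at the vector \<open>inv N (inv N x)\<close>
      is paranormality of the inverse at \<open>x\<close>.\<close>
    show "(norm (?M x))\<^sup>2 \<le> norm (?M (?M x)) * norm x" for x
      using para[of "inv N (inv N x)"] r
      by (simp add: invertible_op_inv_right[OF invN] norm_scaleC bounded_clinear_scaleC[OF bI]
          power_mult_distrib power2_eq_square mult_ac)
    fix l :: complex assume l: "cmod l < 1"
    have "cmod (l * r) < r" using l r by (simp add: norm_mult)
    then have "invertible_op (\<lambda>x. N x - (l * r) *\<^sub>C x)" using r by (intro inv_shift) auto
    from invertible_op_compose(1)[OF this, of "inv N"]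
    show "invertible_op (\<lambda>x. x - l *\<^sub>C ?M x)"
      using invertible_opI(1)[of "inv N" N] bI bN
      by (simp add: invertible_op_inv_right[OF invN] invertible_op_inv_left[OF invN] scaleC_scaleC)
  qed
  then show "r * norm (inv N x) \<le> norm x" using r by (simp add: norm_scaleC)
qed

section \<open>Decompositions of the sequence space\<close>

lemma has_sum_even_odd:
  fixes f :: "nat \<Rightarrow> 'a :: topological_comm_monoid_add"
  assumes "((\<lambda>n. f (2 * n)) has_sum a) UNIV" "((\<lambda>n. f (2 * n + 1)) has_sum b) UNIV"
  shows "(f has_sum (a + b)) UNIV"
proof -
  have "(f has_sum a) (range ((*) 2))" "(f has_sum b) (range (\<lambda>n. 2 * n + 1))"
    using assms by (subst has_sum_reindex; auto simp: inj_on_def o_def)+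
  then have "(f has_sum (a + b)) (range ((*) 2) \<union> range (\<lambda>n. 2 * n + 1))"
    by (rule has_sum_Un_disjoint) (auto, presburger)
  moreover have "range ((*) 2) \<union> range (\<lambda>n. 2 * n + 1) = (UNIV :: nat set)"
    by (auto simp: image_iff) presburger
  ultimately show ?thesis by simp
qed

lemma has_sum_Suc:
  fixes f :: "nat \<Rightarrow> 'a :: topological_comm_monoid_add"
  assumes "((\<lambda>n. f (Suc n)) has_sum a) UNIV"
  shows "(f has_sum (f 0 + a)) UNIV"
proof -
  have "(f has_sum a) (range Suc)"
    using assms by (subst has_sum_reindex) (auto simp: o_def)
  then have "(f has_sum (f 0 + a)) ({0} \<union> range Suc)"
    by (intro has_sum_Un_disjoint) (auto intro: has_sum_finiteI)
  moreover have "{0} \<union> range Suc = UNIV" by (auto simp: image_iff) (metis not0_implies_Suc)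
  ultimately show ?thesis by simp
qed

lemma l2_has_sum_norm: "((\<lambda>i. (norm (l2_nth x i))\<^sup>2) has_sum (norm x)\<^sup>2) UNIV"
  using has_sum_infsum[of "\<lambda>i. (norm (l2_nth x i))\<^sup>2" UNIV] l2_nth[of x]
  by (simp add: norm_l2.rep_eq infsum_nonneg)

lemma l2_has_sum_cinner: "((\<lambda>i. cinner (l2_nth x i) (l2_nth y i)) has_sum cinner x y) UNIV"
  unfolding cinner_l2.rep_eq
  using l2_nth[of x] l2_nth[of y] by (intro has_sum_infsum square_summable_cinner) auto

lemma l2_eqI: "(\<And>i. l2_nth x i = l2_nth y i) \<Longrightarrow> x = y"
  by (simp add: l2_nth_inject[symmetric] fun_eq_iff)

type_synonym 'h seq = "(nat, 'h) l2"

text \<open>Interleaving identifies \<open>'h seq\<close> with the direct sum of two copies of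
  itself, so that all block operators act on one type.\<close>

lift_definition join :: "'h :: complex_inner seq \<Rightarrow> 'h seq \<Rightarrow> 'h seq" is
  "\<lambda>a b n. if even n then a (n div 2) else b (n div 2)"
proof -
  fix a b :: "nat \<Rightarrow> 'h"
  let ?f = "\<lambda>n. (norm (if even n then a (n div 2) else b (n div 2)))\<^sup>2"
  assume "(\<lambda>i. (norm (a i))\<^sup>2) summable_on UNIV" "(\<lambda>i. (norm (b i))\<^sup>2) summable_on UNIV"
  then show "?f summable_on UNIV"
    using has_sum_even_odd[of ?f] by (auto simp: summable_on_def)
qed

lift_definition evens :: "'h :: complex_inner seq \<Rightarrow> 'h seq" is "\<lambda>a n. a (2 * n)"
  using summable_on_reindex[of "(*) (2 :: nat)" UNIV "\<lambda>n. (norm (_ n))\<^sup>2"]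
  by (auto simp: o_def inj_on_def intro: summable_on_subset_banach)

lift_definition odds :: "'h :: complex_inner seq \<Rightarrow> 'h seq" is "\<lambda>a n. a (2 * n + 1)"
  using summable_on_reindex[of "\<lambda>n :: nat. 2 * n + 1" UNIV "\<lambda>n. (norm (_ n))\<^sup>2"]
  by (auto simp: o_def inj_on_def intro: summable_on_subset_banach)

text \<open>Identifies \<open>'h seq\<close> with the direct sum of \<open>'h\<close> and
  \<open>'h seq\<close>; \<open>head\<close> is the adjoint of the embedding of
  \<open>'h\<close>.\<close>

lift_definition cons :: "'h :: complex_inner \<Rightarrow> 'h seq \<Rightarrow> 'h seq" is
  "\<lambda>h a n. case n of 0 \<Rightarrow> h | Suc m \<Rightarrow> a m"
proof -
  fix h :: 'h and a :: "nat \<Rightarrow> 'h"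
  assume "(\<lambda>i. (norm (a i))\<^sup>2) summable_on UNIV"
  then show "(\<lambda>n. (norm (case n of 0 \<Rightarrow> h | Suc m \<Rightarrow> a m))\<^sup>2) summable_on UNIV"
    using has_sum_Suc[of "\<lambda>n. (norm (case n of 0 \<Rightarrow> h | Suc m \<Rightarrow> a m))\<^sup>2"]
    by (auto simp: summable_on_def)
qed

lift_definition tail :: "'h :: complex_inner seq \<Rightarrow> 'h seq" is "\<lambda>a n. a (Suc n)"
  using summable_on_reindex[of Suc UNIV "\<lambda>n. (norm (_ n))\<^sup>2"]
  by (auto simp: o_def intro: summable_on_subset_banach)

abbreviation head :: "'h :: complex_inner seq \<Rightarrow> 'h" where "head x \<equiv> l2_nth x 0"

lemma evens_join [simp]: "evens (join a b) = a"
  and odds_join [simp]: "odds (join a b) = b"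
  and tail_cons [simp]: "tail (cons h a) = a"
  and head_cons [simp]: "head (cons h a) = h"
  by (transfer; simp add: fun_eq_iff)+

lemma join_evens_odds [simp]: "join (evens x) (odds x) = x"
  by (rule l2_eqI) (auto simp: join.rep_eq evens.rep_eq odds.rep_eq)

lemma cons_head_tail [simp]: "cons (head x) (tail x) = x"
  by (rule l2_eqI) (simp add: cons.rep_eq tail.rep_eq split: nat.split)

lemma join_cases: obtains a b where "x = join a b"
  using join_evens_odds[of x] by metis

lemma join_eq_iff [simp]: "join a b = join c d \<longleftrightarrow> a = c \<and> b = d"
  using evens_join odds_join by metis

lemma join_add: "join a b + join c d = join (a + c) (b + d)"
  and join_diff: "join a b - join c d = join (a - c) (b - d)"
  and join_scaleC: "z *\<^sub>C join a b = join (z *\<^sub>C a) (z *\<^sub>C b)"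
  by (transfer; simp add: fun_eq_iff)+

lemma cons_add: "cons h a + cons k b = cons (h + k) (a + b)"
  and cons_diff: "cons h a - cons k b = cons (h - k) (a - b)"
  and cons_scaleC: "z *\<^sub>C cons h a = cons (z *\<^sub>C h) (z *\<^sub>C a)"
  by (transfer; simp add: fun_eq_iff split: nat.split)+

lemma head_linear: "head (x + y) = head x + head y" "head (x - y) = head x - head y"
  "head (z *\<^sub>C x) = z *\<^sub>C head x" "head 0 = 0"
  by (simp_all add: plus_l2.rep_eq minus_l2.rep_eq scaleC_l2.rep_eq zero_l2.rep_eq)

lemma tail_linear: "tail (x + y) = tail x + tail y" "tail (z *\<^sub>C x) = z *\<^sub>C tail x"
  by (transfer; simp)+

lemma cinner_join: "cinner (join a b) (join c d) = cinner a c + cinner b d"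
proof -
  have "((\<lambda>i. cinner (l2_nth (join a b) i) (l2_nth (join c d) i)) has_sum (cinner a c + cinner b d)) UNIV"
    by (rule has_sum_even_odd) (simp_all add: join.rep_eq l2_has_sum_cinner)
  then show ?thesis using l2_has_sum_cinner has_sum_unique by blast
qed

lemma cinner_cons: "cinner (cons h a) (cons k b) = cinner h k + cinner a b"
proof -
  have "((\<lambda>i. cinner (l2_nth (cons h a) i) (l2_nth (cons k b) i)) has_sum
      (cinner (l2_nth (cons h a) 0) (l2_nth (cons k b) 0) + cinner a b)) UNIV"
    by (rule has_sum_Suc) (simp add: cons.rep_eq l2_has_sum_cinner)
  then have "((\<lambda>i. cinner (l2_nth (cons h a) i) (l2_nth (cons k b) i)) has_sum
      (cinner h k + cinner a b)) UNIV" by simp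
  then show ?thesis using l2_has_sum_cinner has_sum_unique by blast
qed

lemma norm_join: "(norm (join a b))\<^sup>2 = (norm a)\<^sup>2 + (norm b)\<^sup>2"
  and norm_cons: "(norm (cons h a))\<^sup>2 = (norm h)\<^sup>2 + (norm a)\<^sup>2"
  by (simp_all add: power2_norm_eq_cinner cinner_join cinner_cons)

lemma norm_join_0 [simp]: "norm (join a 0) = norm a" "norm (join 0 b) = norm b"
  using norm_join[of a 0] norm_join[of 0 b] by (simp_all add: power2_eq_iff_nonneg)

definition diag :: "('h :: complex_inner seq \<Rightarrow> 'h seq) \<Rightarrow> ('h seq \<Rightarrow> 'h seq) \<Rightarrow> 'h seq \<Rightarrow> 'h seq" where
  "diag A B x = join (A (evens x)) (B (odds x))"

lemma diag_join [simp]: "diag A B (join a b) = join (A a) (B b)"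
  by (simp add: diag_def)

lemma bounded_clinear_diag:
  assumes A: "bounded_clinear A" and B: "bounded_clinear B"
  shows "bounded_clinear (diag A B)"
proof (rule bounded_clinearI)
  show "diag A B (x + y) = diag A B x + diag A B y" for x y
    by (cases x rule: join_cases; cases y rule: join_cases)
      (simp add: join_add bounded_clinear_add[OF A] bounded_clinear_add[OF B])
  show "diag A B (z *\<^sub>C x) = z *\<^sub>C diag A B x" for z x
    by (cases x rule: join_cases)
      (simp add: join_scaleC bounded_clinear_scaleC[OF A] bounded_clinear_scaleC[OF B])
  define K where "K = max (onorm A) (onorm B)"
  have K: "0 \<le> K" using bounded_clinear_onorm_nonneg[OF A] by (simp add: K_def)
  have le: "norm (A x) \<le> K * norm x" "norm (B x) \<le> K * norm x" for x
    by (rule order_trans[OF bounded_clinear_bound[OF A] mult_right_mono]; simp add: K_def)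
      (rule order_trans[OF bounded_clinear_bound[OF B] mult_right_mono]; simp add: K_def)
  show "norm (diag A B x) \<le> K * norm x" for x
  proof (cases x rule: join_cases)
    case (1 a b)
    have "(norm (diag A B x))\<^sup>2 \<le> (K * norm a)\<^sup>2 + (K * norm b)\<^sup>2"
      unfolding 1 diag_join norm_join by (intro add_mono power_mono le) auto
    also have "\<dots> = (K * norm x)\<^sup>2"
      unfolding 1 power_mult_distrib norm_join by (simp add: distrib_left)
    finally show ?thesis by (rule power2_le_imp_le) (use K in simp)
  qed
qed

lemma diag_invertible:
  assumes A: "invertible_op A" and B: "invertible_op B"
  shows "invertible_op (diag A B)"
proof (rule invertible_opI(1))
  show "bounded_clinear (diag A B)" "bounded_clinear (diag (inv A) (inv B))"
    by (intro bounded_clinear_diag invertible_op_bounded_clinear invertible_op_bounded_clinear_inv assms)+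
  show "diag (inv A) (inv B) (diag A B x) = x" "diag A B (diag (inv A) (inv B) x) = x" for x
    by (cases x rule: join_cases; simp add: invertible_op_inv_left[OF A] invertible_op_inv_left[OF B]
        invertible_op_inv_right[OF A] invertible_op_inv_right[OF B])+
qed

section \<open>Isometric and unitary dilations\<close>

text \<open>The successive squared norms of \<open>h, T h, T\<^sup>* T h, T T\<^sup>* T h, \<dots>\<close> decrease, and
  the second difference of that sequence is the squared norm of \<open>alternate n - alternate (n + 2)\<close>. So
  the defect \<open>(norm h)\<^sup>2 - (norm (T h))\<^sup>2\<close> telescopes, without any square root of \<open>1 - T\<^sup>* T\<close>.\<close>

fun alternate :: "('h \<Rightarrow> 'h) \<Rightarrow> ('h \<Rightarrow> 'h) \<Rightarrow> nat \<Rightarrow> 'h \<Rightarrow> 'h" where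
  "alternate T S 0 h = h"
| "alternate T S (Suc n) h = (if even n then T else S) (alternate T S n h)"

lemma alternate_defect_has_sum:
  fixes T :: "'h :: complex_inner \<Rightarrow> 'h"
  assumes adj: "\<And>x y. cinner (T x) y = cinner x (S y)" and le: "\<And>x. norm (T x) \<le> norm x"
  shows "((\<lambda>n. (norm (alternate T S n h - alternate T S (n + 2) h))\<^sup>2) has_sum
           ((norm h)\<^sup>2 - (norm (T h))\<^sup>2)) UNIV"
proof -
  define u where "u n = alternate T S n h" for n
  define g where "g n = (norm (u n))\<^sup>2" for n
  have leS: "norm (S y) \<le> norm y" for y by (rule adjoint_contraction[OF adj le])
  note adjS = adjoint_flip[OF adj]
  have second_diff: "(norm (u n - u (n + 2)))\<^sup>2 = (g n - g (Suc n)) - (g (Suc n) - g (Suc (Suc n)))" for n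
  proof -
    \<comment> \<open>Passing from \<open>u (n + 1)\<close> to \<open>u (n + 2)\<close> applies the
      adjoint of the map that led from \<open>u n\<close> to \<open>u (n + 1)\<close>, whatever the
      parity of \<open>n\<close>.\<close>
    have "cinner (u n) (u (n + 2)) = cinner (u (Suc n)) (u (Suc n))"
      by (simp add: u_def adj adjS)
    then have "Re (cinner (u n) (u (n + 2))) = g (Suc n)"
      by (simp only: g_def power2_norm_eq_cinner)
    then show ?thesis by (simp add: g_def power2_norm_diff)
  qed
  have "norm (u (Suc n)) \<le> norm (u n)" for n by (simp add: u_def le leS)
  then have dec: "decseq g" by (intro decseq_SucI) (simp add: g_def power_mono)
  then obtain L where L: "g \<longlonglongrightarrow> L"
    using decseq_convergent[of g 0] by (auto simp: g_def)
  \<comment> \<open>The first differences tend to 0, so the second differences sum to the initial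
    first difference \<open>g 0 - g 1\<close>.\<close>
  have "(\<lambda>n. g n - g (Suc n)) \<longlonglongrightarrow> L - L"
    by (intro tendsto_diff L LIMSEQ_Suc)
  from telescope_sums'[OF this]
  have "(\<lambda>n. (norm (u n - u (n + 2)))\<^sup>2) sums (g 0 - g 1)"
    unfolding second_diff by simp
  then show ?thesis
    by (intro sums_nonneg_imp_has_sum) (simp_all add: u_def g_def)
qed

text \<open>\<open>D\<close> takes the place of the square root of \<open>1 - T\<^sup>* T\<close>:
  it satisfies the same norm identity, with values in the sequence space.\<close>

lemma defect_operator_exists:
  fixes T :: "'h :: chilbert_space \<Rightarrow> 'h"
  assumes T: "bounded_clinear T" and le: "\<And>x. norm (T x) \<le> norm x"
  obtains D :: "'h \<Rightarrow> 'h seq" where "\<And>x y. D (x + y) = D x + D y" "\<And>a x. D (a *\<^sub>C x) = a *\<^sub>C D x"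
    "\<And>x. (norm (T x))\<^sup>2 + (norm (D x))\<^sup>2 = (norm x)\<^sup>2"
proof -
  obtain S where S: "bounded_clinear S" and adj: "\<And>x y. cinner (T x) y = cinner x (S y)"
    using adjoint_exists[OF T] by metis
  note sum = alternate_defect_has_sum[OF adj le]
  have add: "alternate T S n (x + y) = alternate T S n x + alternate T S n y" for n x y
    by (induction n) (simp_all add: bounded_clinear_add S T)
  have scale: "alternate T S n (a *\<^sub>C x) = a *\<^sub>C alternate T S n x" for n a x
    by (induction n) (simp_all add: bounded_clinear_scaleC S T)
  define D where "D h = Abs_l2 (\<lambda>n. alternate T S n h - alternate T S (n + 2) h)" for h
  have nth: "l2_nth (D h) n = alternate T S n h - alternate T S (n + 2) h" for h n
    unfolding D_def using sum[of h] by (subst Abs_l2_inverse) (auto simp: summable_on_def)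
  show thesis
  proof (rule that)
    show "D (x + y) = D x + D y" for x y
      by (rule l2_eqI) (simp add: nth plus_l2.rep_eq add del: alternate.simps)
    show "D (a *\<^sub>C x) = a *\<^sub>C D x" for a x
      by (rule l2_eqI) (simp add: nth scaleC_l2.rep_eq scale scaleC_diff_right del: alternate.simps)
    show "(norm (T x))\<^sup>2 + (norm (D x))\<^sup>2 = (norm x)\<^sup>2" for x
      using has_sum_unique[OF sum[of x] l2_has_sum_norm[of "D x", unfolded nth]] by simp
  qed
qed

text \<open>Schaeffer's construction: \<open>T\<close> acts on the head, and its defect is
  interleaved with the old tail. Space and \<open>head\<close> do not depend on \<open>T\<close>, so
  two contractions can be lifted to a common space.\<close>

lemma isometric_lifting_exists:
  fixes T :: "'h :: chilbert_space \<Rightarrow> 'h"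
  assumes T: "bounded_clinear T" and le: "\<And>x. norm (T x) \<le> norm x"
  obtains Y :: "'h seq \<Rightarrow> 'h seq" where "isometry_op Y" "\<And>x. head (Y x) = T (head x)"
proof -
  obtain D :: "'h \<Rightarrow> 'h seq" where D: "\<And>x y. D (x + y) = D x + D y"
    "\<And>a x. D (a *\<^sub>C x) = a *\<^sub>C D x" "\<And>x. (norm (T x))\<^sup>2 + (norm (D x))\<^sup>2 = (norm x)\<^sup>2"
    using defect_operator_exists[OF T le] by blast
  define Y where "Y x = cons (T (head x)) (join (D (head x)) (tail x))" for x
  have norm: "norm (Y x) = norm x" for x
  proof -
    have "(norm (Y x))\<^sup>2 = (norm (head x))\<^sup>2 + (norm (tail x))\<^sup>2"
      unfolding Y_def norm_cons norm_join using D(3)[of "head x"] by simp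
    also have "\<dots> = (norm x)\<^sup>2" using norm_cons[of "head x" "tail x"] by simp
    finally show ?thesis by (simp add: power2_eq_iff_nonneg)
  qed
  have "bounded_clinear Y"
    by (rule bounded_clinearI[where K = 1])
      (simp_all add: norm, simp_all add: Y_def head_linear tail_linear D bounded_clinear_add[OF T]
        bounded_clinear_scaleC[OF T] cons_add join_add cons_scaleC join_scaleC)
  with norm show thesis by (intro that[of Y]) (auto simp: isometry_op_def Y_def)
qed

text \<open>Halmos' unitary extension, with block matrix \<open>[[Y, 1 - Y Y\<^sup>*], [0, Y\<^sup>*]]\<close>.\<close>

lemma unitary_extension_exists:
  fixes Y :: "'h :: chilbert_space seq \<Rightarrow> 'h seq"
  assumes Y: "isometry_op Y"
  obtains U W where "isometry_op U" "isometry_op W" "\<And>x. W (U x) = x" "\<And>x. U (W x) = x"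
    "\<And>x. U (join x 0) = join (Y x) 0"
proof -
  have bY: "bounded_clinear Y" using Y by (simp add: isometry_op_def)
  obtain S where S: "bounded_clinear S" and adj: "\<And>x y. cinner (Y x) y = cinner x (S y)"
    using adjoint_exists[OF bY] by metis
  note adj' = adjoint_flip[OF adj, symmetric]
  have SY: "S (Y x) = x" for x
    by (rule cinner_ext) (simp add: isometry_cinner[OF Y] flip: adj)
  note lin = bounded_clinear_add[OF bY] bounded_clinear_add[OF S] bounded_clinear_diff[OF bY]
    bounded_clinear_diff[OF S] bounded_clinear_scaleC[OF bY] bounded_clinear_scaleC[OF S]
    bounded_clinear_0[OF bY] bounded_clinear_0[OF S]
  define U where "U x = join (Y (evens x) + (odds x - Y (S (odds x)))) (S (odds x))" for x
  define W where "W x = join (S (evens x)) (evens x - Y (S (evens x)) + Y (odds x))" for x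
  have U: "U (join a b) = join (Y a + (b - Y (S b))) (S b)" for a b by (simp add: U_def)
  have W: "W (join a b) = join (S a) (a - Y (S a) + Y b)" for a b by (simp add: W_def)
  have WU: "W (U x) = x" and UW: "U (W x) = x" for x
    by (cases x rule: join_cases; simp add: U W lin SY)+
  \<comment> \<open>\<open>W\<close> is both inverse and adjoint of \<open>U\<close>, whence
    \<open>U\<close> preserves norms.\<close>
  have adjU: "cinner (U x) y = cinner x (W y)" for x y
    by (cases x rule: join_cases; cases y rule: join_cases)
      (simp add: U W cinner_join cinner_add_left cinner_add_right cinner_diff_left
        cinner_diff_right adj adj')
  have norm: "norm (U x) = norm x" for x
  proof -
    have "cinner (U x) (U x) = cinner x x" by (simp add: adjU WU)
    then show ?thesis by (simp add: cinner_self power2_eq_iff_nonneg flip: of_real_power)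
  qed
  have normW: "norm (W x) = norm x" for x using norm[of "W x"] by (simp add: UW)
  have "U (x + y) = U x + U y" "W (x + y) = W x + W y"
    "U (z *\<^sub>C x) = z *\<^sub>C U x" "W (z *\<^sub>C x) = z *\<^sub>C W x" for x y z
    by (cases x rule: join_cases; cases y rule: join_cases;
        simp add: U W lin join_add join_scaleC scaleC_diff_right scaleC_add_right)+
  then have "isometry_op U" "isometry_op W"
    unfolding isometry_op_def using norm normW
    by (auto intro!: bounded_clinearI[where K = 1])
  then show thesis using WU UW by (rule that) (simp add: U lin)
qed

text \<open>For \<open>1 < cmod z\<close> it is enough that \<open>U\<close> is a contraction. For
  \<open>0 < cmod z < 1\<close> the factorization \<open>U - z = - z (W - 1/z) U\<close> passes to
  the contraction \<open>W\<close>.\<close>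

lemma isometry_minus_scaleC_invertible:
  fixes U :: "'k :: chilbert_space \<Rightarrow> 'k"
  assumes U: "isometry_op U" and W: "isometry_op W" and inv: "\<And>x. W (U x) = x" "\<And>x. U (W x) = x"
    and z: "cmod z \<noteq> 1"
  shows "invertible_op (\<lambda>x. U x - z *\<^sub>C x)"
proof -
  have bU: "bounded_clinear U" and bW: "bounded_clinear W"
    using U W by (auto simp: isometry_op_def)
  have iU: "invertible_op U" using bU bW inv by (rule invertible_opI(1))
  consider "z = 0" | "1 < cmod z" | "z \<noteq> 0" "cmod z < 1" using z by linarith
  then show ?thesis
  proof cases
    case 1
    then show ?thesis using iU by simp
  next
    case 2
    then show ?thesis using U by (intro contraction_minus_scaleC_invertible) (auto simp: isometry_op_def)
  next
    case 3
    then have "invertible_op (\<lambda>x. W x - (1 / z) *\<^sub>C x)"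
      using W by (intro contraction_minus_scaleC_invertible) (auto simp: isometry_op_def norm_divide)
    then have "invertible_op (\<lambda>x. (- z) *\<^sub>C (W (U x) - (1 / z) *\<^sub>C U x))"
      using 3(1) by (intro invertible_op_scaleC invertible_op_compose(1)[OF _ iU]) auto
    then show ?thesis using 3(1) by (simp add: inv scaleC_diff_right scaleC_scaleC)
  qed
qed

section \<open>Rational functions of an operator\<close>

lemma scaleC_sum_right: "a *\<^sub>C (\<Sum>i\<in>I. f i) = (\<Sum>i\<in>I. a *\<^sub>C (f i :: 'a :: complex_inner))"
  by (induction I rule: infinite_finite_induct) (simp_all add: scaleC_add_right)

lemma poly_op_eq_sum:
  assumes "degree p \<le> n"
  shows "poly_op p A x = (\<Sum>i\<le>n. coeff p i *\<^sub>C (A ^^ i) x)"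
  unfolding poly_op_def using assms
  by (intro sum.mono_neutral_left) (auto simp: coeff_eq_0)

lemma poly_op_add: "poly_op (p + q) A x = poly_op p A x + poly_op q A x"
  using degree_add_le[of p "max (degree p) (degree q)" q]
  by (simp add: poly_op_eq_sum[of _ "max (degree p) (degree q)"] scaleC_add_left sum.distrib)

lemma poly_op_smult: "poly_op (smult a p) A x = a *\<^sub>C poly_op p A x"
  by (simp add: poly_op_eq_sum[OF degree_smult_le] poly_op_def scaleC_sum_right scaleC_scaleC)

lemma poly_op_0: "poly_op 0 A x = 0"
  by (simp add: poly_op_def)

lemma poly_op_pCons:
  assumes A: "bounded_clinear A"
  shows "poly_op (pCons c p) A x = c *\<^sub>C x + A (poly_op p A x)"
proof (cases "p = 0")
  case False
  have "A (poly_op p A x) = (\<Sum>i\<le>degree p. coeff p i *\<^sub>C A ((A ^^ i) x))"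
    unfolding poly_op_def
    by (simp add: linear_sum[OF bounded_linear.linear[OF bounded_clinear_imp_bounded_linear[OF A]]]
        bounded_clinear_scaleC[OF A])
  with False show ?thesis
    by (simp add: poly_op_def sum.atMost_Suc_shift del: sum.atMost_Suc)
qed (simp add: poly_op_def bounded_clinear_0[OF A])

lemma poly_op_linear_factor:
  assumes "bounded_clinear A"
  shows "poly_op ([:- a, 1:] * q) A = (\<lambda>x. A (poly_op q A x) - a *\<^sub>C poly_op q A x)"
proof
  fix x
  have "[:- a, 1:] * q = smult (- a) q + pCons 0 q" by simp
  then show "poly_op ([:- a, 1:] * q) A x = A (poly_op q A x) - a *\<^sub>C poly_op q A x"
    by (simp only: poly_op_add poly_op_smult poly_op_pCons[OF assms]) simp
qed

text \<open>\<open>A\<close> compresses to \<open>B\<close> along \<open>J\<close>: since \<open>A\<close> leaves the range of \<open>J\<close> invariant, where it acts as an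
  operator intertwined with \<open>B\<close> by \<^const>\<open>head\<close>, this is stable under composition.\<close>

definition compresses ::
  "('h :: complex_inner seq \<Rightarrow> 'k :: complex_inner) \<Rightarrow> ('k \<Rightarrow> 'k) \<Rightarrow> ('h \<Rightarrow> 'h) \<Rightarrow> bool" where
  "compresses J A B \<longleftrightarrow> (\<exists>R. (\<forall>x. A (J x) = J (R x)) \<and> (\<forall>x. head (R x) = B (head x)))"

lemma compresses_compose:
  assumes "compresses J A B" "compresses J A' B'"
  shows "compresses J (\<lambda>x. A (A' x)) (\<lambda>x. B (B' x))"
proof -
  obtain R R' where "\<forall>x. A (J x) = J (R x)" "\<forall>x. head (R x) = B (head x)"
    "\<forall>x. A' (J x) = J (R' x)" "\<forall>x. head (R' x) = B' (head x)"
    using assms unfolding compresses_def by blast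
  then show ?thesis unfolding compresses_def by (intro exI[of _ "\<lambda>x. R (R' x)"]) simp
qed

lemma compresses_scaleC:
  assumes "bounded_clinear J"
  shows "compresses J (\<lambda>x. a *\<^sub>C x) (\<lambda>x. a *\<^sub>C x)"
  unfolding compresses_def
  by (intro exI[of _ "\<lambda>x. a *\<^sub>C x"]) (simp add: bounded_clinear_scaleC[OF assms] head_linear)

lemma compresses_add:
  assumes J: "bounded_clinear J" and "compresses J A B" "compresses J A' B'"
  shows "compresses J (\<lambda>x. A x + A' x) (\<lambda>x. B x + B' x)"
proof -
  obtain R R' where "\<forall>x. A (J x) = J (R x)" "\<forall>x. head (R x) = B (head x)"
    "\<forall>x. A' (J x) = J (R' x)" "\<forall>x. head (R' x) = B' (head x)"
    using assms unfolding compresses_def by blast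
  then show ?thesis unfolding compresses_def
    by (intro exI[of _ "\<lambda>x. R x + R' x"]) (simp add: bounded_clinear_add[OF J] head_linear)
qed

text \<open>\<open>R\<close> solves \<open>A y = J x\<close> inside the range of \<open>J\<close>,
  with a head that solves the equation for \<open>B\<close>. Invertibility makes these solutions the
  values of the inverses.\<close>

lemma compresses_inv:
  assumes A: "invertible_op A" and B: "invertible_op B"
    and R: "\<And>x. A (J (R x)) = J x" "\<And>x. B (head (R x)) = head x"
  shows "compresses J (inv A) (inv B)"
  unfolding compresses_def
proof (intro exI[of _ R] conjI allI)
  show "inv A (J x) = J (R x)" for x by (rule invertible_op_inv_eq[OF A R(1)])
  show "head (R x) = inv B (head x)" for x using invertible_op_inv_eq[OF B R(2)] by simp
qed

lemma compresses_poly_op: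
  assumes J: "bounded_clinear J" and "bounded_clinear A" "bounded_clinear B" "compresses J A B"
  shows "compresses J (poly_op p A) (poly_op p B)"
proof (induction p)
  case 0
  show ?case using compresses_scaleC[OF J, of 0] by (simp add: poly_op_0[abs_def])
next
  case (pCons c p)
  show ?case
    unfolding poly_op_pCons[OF assms(2), abs_def] poly_op_pCons[OF assms(3), abs_def]
    by (rule compresses_add[OF J compresses_scaleC[OF J] compresses_compose[OF assms(4) pCons(2)]])
qed

text \<open>Induction on the degree: the fundamental theorem of algebra splits off a linear factor,
  and both invertibility and compression pass to compositions. This reduces everything to the
  resolvents at the zeros.\<close>

lemma poly_op_invertible_compresses_inv:
  assumes J: "bounded_clinear J" and A: "bounded_clinear A" and B: "bounded_clinear B"
    and "q \<noteq> 0"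
    and "\<And>z. poly q z = 0 \<Longrightarrow> invertible_op (\<lambda>x. A x - z *\<^sub>C x)"
    and "\<And>z. poly q z = 0 \<Longrightarrow> invertible_op (\<lambda>x. B x - z *\<^sub>C x)"
    and "\<And>z. poly q z = 0 \<Longrightarrow>
           compresses J (inv (\<lambda>x. A x - z *\<^sub>C x)) (inv (\<lambda>x. B x - z *\<^sub>C x))"
  shows "invertible_op (poly_op q A) \<and> invertible_op (poly_op q B) \<and>
    compresses J (inv (poly_op q A)) (inv (poly_op q B))"
  using assms(4-)
proof (induction "degree q" arbitrary: q)
  case 0
  then obtain c where q: "q = [:c:]" by (metis degree_eq_zeroE)
  with 0 have c: "c \<noteq> 0" by simp
  have eq: "poly_op q C = (\<lambda>x. c *\<^sub>C x)" for C :: "'x :: complex_inner \<Rightarrow> 'x"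
    by (simp add: q poly_op_def)
  have inv: "invertible_op (\<lambda>x :: 'x :: complex_inner. c *\<^sub>C x)"
    "inv (\<lambda>x :: 'x. c *\<^sub>C x) = (\<lambda>x. inverse c *\<^sub>C x)"
    by (rule invertible_opI[of _ "\<lambda>x. inverse c *\<^sub>C x"];
        simp add: bounded_clinear_scaleC_left scaleC_scaleC c)+
  show ?case unfolding eq by (simp add: inv compresses_scaleC[OF J])
next
  case (Suc n)
  then have "\<exists>i\<in>{1..degree q}. coeff q i \<noteq> 0"
    by (intro bexI[of _ "degree q"]) auto
  then obtain a where a: "poly q a = 0"
    using fundamental_theorem_of_algebra[of "coeff q" "degree q"] unfolding poly_altdef by blast
  then obtain p where q: "q = [:- a, 1:] * p" by (metis poly_eq_0_iff_dvd dvdE)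
  have p0: "p \<noteq> 0" using Suc.prems(1) q by auto
  then have "n = degree p"
    using Suc.hyps(2) unfolding q by (subst (asm) degree_mult_eq) auto
  moreover have "poly q z = 0" if "poly p z = 0" for z using that q by simp
  ultimately have IH: "invertible_op (poly_op p A)" "invertible_op (poly_op p B)"
    "compresses J (inv (poly_op p A)) (inv (poly_op p B))"
    using Suc.hyps(1)[of p] p0 Suc.prems(2-) by auto
  note a' = Suc.prems(2-4)[OF a]
  show ?case
    unfolding q poly_op_linear_factor[OF A] poly_op_linear_factor[OF B]
      invertible_op_compose(2)[OF a'(1) IH(1)] invertible_op_compose(2)[OF a'(2) IH(2)]
    using invertible_op_compose(1)[OF a'(1) IH(1)] invertible_op_compose(1)[OF a'(2) IH(2)]
      compresses_compose[OF IH(3) a'(3)] by blast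
qed

section \<open>The dilation theorem\<close>

lemma C1_iff:
  assumes r: "0 < r" and T: "invertible_op T"
  shows "T \<in> C1 r \<longleftrightarrow> (\<forall>x. norm (T x) \<le> norm x) \<and> (\<forall>x. r * norm (inv T x) \<le> norm x)"
proof
  assume C1: "T \<in> C1 r"
  have bT: "bounded_clinear T" and bI: "bounded_clinear (\<lambda>x. r *\<^sub>R inv T x)"
    using bounded_clinear_scaleC_left[of "inv T" r] T
    by (auto simp: scaleR_scaleC invertible_op_bounded_clinear invertible_op_bounded_clinear_inv)
  have o: "onorm T \<le> 1" "onorm (\<lambda>x. r *\<^sub>R inv T x) \<le> 1" using C1 by (auto simp: C1_def)
  have "norm (T x) \<le> norm x" for x
    using order_trans[OF bounded_clinear_bound[OF bT] mult_right_mono[OF o(1)], of x] by simp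
  moreover have "r * norm (inv T x) \<le> norm x" for x
    using order_trans[OF bounded_clinear_bound[OF bI] mult_right_mono[OF o(2)], of x] r by simp
  ultimately show "(\<forall>x. norm (T x) \<le> norm x) \<and> (\<forall>x. r * norm (inv T x) \<le> norm x)" by blast
next
  assume "(\<forall>x. norm (T x) \<le> norm x) \<and> (\<forall>x. r * norm (inv T x) \<le> norm x)"
  then show "T \<in> C1 r" using r T by (auto simp: C1_def intro!: onorm_bound)
qed

lemma annulus_dilation_imp_C1:
  fixes T :: "'h :: chilbert_space \<Rightarrow> 'h" and V :: "'h \<Rightarrow> 'k :: chilbert_space"
  assumes r: "0 < r" "r < 1" and T: "invertible_op T" and dil: "annulus_dilation r T V N F"
  shows "T \<in> C1 r"
proof -
  have V: "isometry_op V" and N: "annulus_unitary r N" and F: "selfadjoint_op F" "unitary_op F"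
    using dil by (auto simp: annulus_dilation_def)
  have nV: "norm (V x) = norm x" for x using V by (simp add: isometry_op_def)
  note nN = annulus_unitary_norm_bounds[OF r N]
  have bF: "bounded_clinear F" and FF: "F (F x) = x" for x
    using F by (auto simp: selfadjoint_op_def unitary_op_def fun_eq_iff)
  have nF: "norm (F x) = norm x" for x
  proof -
    have "cinner (F x) (F x) = cinner x x"
      using cinner_cadjoint[OF bF, of x "F x"] F(1) by (simp add: selfadjoint_op_def FF)
    then show ?thesis by (simp add: cinner_self power2_eq_iff_nonneg flip: of_real_power)
  qed
  have iF: "invertible_op F" "inv F = F"
    using invertible_opI[OF bF bF] FF by auto
  \<comment> \<open>\<open>F\<close> is a norm-preserving involution, so this inverse inherits the
    norm bound of \<open>inv N\<close>.\<close>
  have invFNF: "inv (F \<circ> N \<circ> F) = (\<lambda>x. F (inv N (F x)))"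
    using invertible_op_compose[OF iF(1) invertible_op_compose(1)[OF nN(2) iF(1)]]
      invertible_op_compose(2)[OF nN(2) iF(1)] by (simp add: o_def iF(2))
  have one: "poly_op 1 A = id" for A :: "'x :: complex_inner \<Rightarrow> 'x"
    by (simp add: poly_op_def fun_eq_iff)
  have X: "poly_op [:0, 1:] A = A" for A :: "'x :: complex_inner \<Rightarrow> 'x"
    by (simp add: poly_op_def fun_eq_iff)
  have id: "V ((poly_op p T \<circ> inv (poly_op q1 T) \<circ> inv (poly_op q2 T)) h) =
      orth_proj (range V) ((poly_op p N \<circ> inv (poly_op q1 N) \<circ> inv (poly_op q2 (F \<circ> N \<circ> F))) (V h))"
    if "\<And>z. poly q1 z = 0 \<Longrightarrow> z \<notin> cball 0 1" "\<And>z. poly q2 z = 0 \<Longrightarrow> z \<in> ball 0 r" for p q1 q2 h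
    using dil that unfolding annulus_dilation_def by blast
  have "norm (T h) \<le> norm h" for h
  proof -
    have "V (T h) = orth_proj (range V) (N (V h))"
      using id[of 1 1 "[:0, 1:]"] by (simp add: one X inv_id)
    then show ?thesis
      using order_trans[OF orth_proj_range_norm_le[OF V, of "N (V h)"] nN(1)] nV by metis
  qed
  moreover have "r * norm (inv T h) \<le> norm h" for h
  proof -
    \<comment> \<open>The choice \<open>p = q1 = 1\<close>, \<open>q2 = [:0, 1:]\<close> is
      admissible because the only zero, 0, lies in \<open>ball 0 r\<close>.\<close>
    have "V (inv T h) = orth_proj (range V) (F (inv N (F (V h))))"
      using id[of 1 "[:0, 1:]" 1] r by (simp add: one X inv_id invFNF)
    then have "norm (inv T h) \<le> norm (inv N (F (V h)))"
      using orth_proj_range_norm_le[OF V, of "F (inv N (F (V h)))"] nV nF by metis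
    then have "r * norm (inv T h) \<le> r * norm (inv N (F (V h)))" using r by simp
    also have "\<dots> \<le> norm h" using nN(3)[of "F (V h)"] by (simp add: nF nV)
    finally show ?thesis .
  qed
  ultimately show ?thesis using C1_iff[OF r(1) T] by blast
qed

text \<open>For nonzero \<open>b\<close> this is \<open>- b (A - a/b)\<close> with
  \<open>cmod (a/b) > 1\<close>. The homogeneous form includes \<open>b = 0\<close>, as is required
  for a zero of \<open>q2\<close> at the origin.\<close>

lemma contraction_scaleC_minus_invertible:
  fixes A :: "'a :: chilbert_space \<Rightarrow> 'a"
  assumes A: "bounded_clinear A" and le: "\<And>x. norm (A x) \<le> norm x" and ab: "cmod b < cmod a"
  shows "invertible_op (\<lambda>x. a *\<^sub>C x - b *\<^sub>C A x)"
proof (cases "b = 0")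
  case True
  then show ?thesis using invertible_op_scaleC[OF invertible_op_id, of a] ab by auto
next
  case False
  then have "1 < cmod (a / b)" using ab by (simp add: norm_divide)
  from invertible_op_scaleC[OF contraction_minus_scaleC_invertible[OF A le this], of "- b"]
  show ?thesis using False by (simp add: scaleC_diff_right scaleC_scaleC)
qed

lemma inverse_isometries_adjoint:
  assumes "isometry_op U" "\<And>x. U (W x) = x"
  shows "cinner (U x) y = cinner x (W y)"
  using isometry_cinner[OF assms(1), of x "W y"] by (simp add: assms(2))

text \<open>With \<open>S = r T\<^sup>-\<^sup>1\<close> and unitaries \<open>U, X\<close> that extend isometric liftings of \<open>T, S\<close> on a common
  space, take \<open>N = U \<oplus> r X\<^sup>-\<^sup>1\<close> and let \<open>F\<close> swap the two summands.\<close>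

lemma annulus_dilation_exists:
  fixes T :: "'h :: chilbert_space \<Rightarrow> 'h"
  assumes r: "0 < r" "r < 1" and T: "invertible_op T" and C1: "T \<in> C1 r"
  shows "\<exists>(V :: 'h \<Rightarrow> 'h seq) N F. annulus_dilation r T V N F"
proof -

  \<comment> \<open>Liftings of \<open>T\<close> and \<open>S\<close> and their unitary
    extensions\<close>
  let ?r = "complex_of_real r"
  have bT: "bounded_clinear T" by (rule invertible_op_bounded_clinear[OF T])
  have leT: "norm (T x) \<le> norm x" and leI: "r * norm (inv T x) \<le> norm x" for x
    using C1 C1_iff[OF r(1) T] by auto
  define S where "S x = ?r *\<^sub>C inv T x" for x
  have bS: "bounded_clinear S"
    unfolding S_def by (intro bounded_clinear_scaleC_left invertible_op_bounded_clinear_inv[OF T])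
  have leS: "norm (S x) \<le> norm x" for x using leI r by (simp add: S_def norm_scaleC)
  have TS: "T (S x) = ?r *\<^sub>C x" for x
    by (simp add: S_def bounded_clinear_scaleC[OF bT] invertible_op_inv_right[OF T])
  obtain Y :: "'h seq \<Rightarrow> 'h seq" where Y: "isometry_op Y" "\<And>x. head (Y x) = T (head x)"
    using isometric_lifting_exists[OF bT leT] by blast
  obtain Z :: "'h seq \<Rightarrow> 'h seq" where Z: "isometry_op Z" "\<And>x. head (Z x) = S (head x)"
    using isometric_lifting_exists[OF bS leS] by blast
  have bY: "bounded_clinear Y" and bZ: "bounded_clinear Z"
    and leY: "norm (Y x) \<le> norm x" and leZ: "norm (Z x) \<le> norm x" for x
    using Y(1) Z(1) by (auto simp: isometry_op_def)
  obtain U U' where U: "isometry_op U" "isometry_op U'" "\<And>x. U' (U x) = x" "\<And>x. U (U' x) = x"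
    "\<And>x. U (join x 0) = join (Y x) 0"
    using unitary_extension_exists[OF Y(1)] by blast
  obtain X X' where X: "isometry_op X" "isometry_op X'" "\<And>x. X' (X x) = x" "\<And>x. X (X' x) = x"
    "\<And>x. X (join x 0) = join (Z x) 0"
    using unitary_extension_exists[OF Z(1)] by blast
  have bU: "bounded_clinear U" "bounded_clinear U'" and bX: "bounded_clinear X" "bounded_clinear X'"
    using U X by (auto simp: isometry_op_def)

  define N where "N = diag U (\<lambda>x. ?r *\<^sub>C X' x)"
  define F :: "'h seq \<Rightarrow> 'h seq" where "F x = join (odds x) (evens x)" for x
  \<comment> \<open>The inner \<open>join\<close> puts \<open>x\<close> where \<open>U\<close> and
    \<open>X\<close> extend \<open>Y\<close> and \<open>Z\<close>; the outer one selects the first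
    summand of \<open>N\<close>.\<close>
  define J :: "'h seq \<Rightarrow> 'h seq" where "J x = join (join x 0) 0" for x
  define V :: "'h \<Rightarrow> 'h seq" where "V h = J (cons h 0)" for h

  \<comment> \<open>Normality and spectrum of \<open>N\<close>\<close>
  have bN: "bounded_clinear N"
    unfolding N_def by (intro bounded_clinear_diag bounded_clinear_scaleC_left bU bX)
  have N_shift: "invertible_op (\<lambda>x. N x - z *\<^sub>C x)" if z: "cmod z \<noteq> 1" "cmod z \<noteq> r" for z
  proof -
    have "cmod (z / ?r) \<noteq> 1" using z r by (simp add: norm_divide)
    then have "invertible_op (diag (\<lambda>x. U x - z *\<^sub>C x) (\<lambda>x. ?r *\<^sub>C (X' x - (z / ?r) *\<^sub>C x)))"
      using r by (intro diag_invertible invertible_op_scaleC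
          isometry_minus_scaleC_invertible[OF U(1-4) z(1)]
          isometry_minus_scaleC_invertible[OF X(2,1,4,3)]) auto
    also have "diag (\<lambda>x. U x - z *\<^sub>C x) (\<lambda>x. ?r *\<^sub>C (X' x - (z / ?r) *\<^sub>C x)) = (\<lambda>x. N x - z *\<^sub>C x)"
    proof
      show "diag (\<lambda>x. U x - z *\<^sub>C x) (\<lambda>x. ?r *\<^sub>C (X' x - (z / ?r) *\<^sub>C x)) x = N x - z *\<^sub>C x" for x
        using r by (cases x rule: join_cases)
          (simp add: N_def join_scaleC join_diff scaleC_diff_right scaleC_scaleC)
    qed
    finally show ?thesis .
  qed
  have adjN: "cadjoint N = diag U' (\<lambda>x. ?r *\<^sub>C X x)"
  proof (rule cadjoint_eqI)
    show "cinner (N x) y = cinner x (diag U' (\<lambda>x. ?r *\<^sub>C X x) y)" for x y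
      by (cases x rule: join_cases; cases y rule: join_cases)
        (simp add: N_def cinner_join cinner_scaleC_left cinner_scaleC_right
          inverse_isometries_adjoint[OF U(1,4)] inverse_isometries_adjoint[OF X(2,3)])
  qed
  have "cadjoint N (N x) = N (cadjoint N x)" for x
    unfolding adjN unfolding N_def
    by (cases x rule: join_cases) (simp add: U X bounded_clinear_scaleC[OF bX(1)] bounded_clinear_scaleC[OF bX(2)])
  then have "normal_op N" using bN by (simp add: normal_op_def fun_eq_iff)
  then have unitN: "annulus_unitary r N"
    using N_shift by (fastforce simp: annulus_unitary_def spectrum_def)

  \<comment> \<open>The swap as a selfadjoint unitary\<close>
  have F_join: "F (join a b) = join b a" for a b by (simp add: F_def)
  have FF: "F (F x) = x" for x by (cases x rule: join_cases) (simp add: F_join)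
  have adjF: "cinner (F x) y = cinner x (F y)" for x y
    by (cases x rule: join_cases; cases y rule: join_cases) (simp add: F_join cinner_join)
  have bF: "bounded_clinear F"
  proof (rule bounded_clinearI[where K = 1])
    show "F (x + y) = F x + F y" for x y
      by (cases x rule: join_cases; cases y rule: join_cases) (simp add: F_join join_add)
    show "F (a *\<^sub>C x) = a *\<^sub>C F x" for a x
      by (cases x rule: join_cases) (simp add: F_join join_scaleC)
    show "norm (F x) \<le> 1 * norm x" for x
      by (rule power2_le_imp_le; cases x rule: join_cases) (simp_all add: F_join norm_join)
  qed
  have F: "selfadjoint_op F" "unitary_op F"
    using bF FF cadjoint_eqI[OF adjF] by (auto simp: selfadjoint_op_def unitary_op_def fun_eq_iff)
  have iF: "invertible_op F" using bF bF FF FF by (rule invertible_opI(1))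

  \<comment> \<open>The embeddings \<open>J\<close> and \<open>V\<close> and the projection onto
    \<open>range V\<close>\<close>
  have nJ: "norm (J x) = norm x" for x by (simp add: J_def)
  have J: "isometry_op J"
    unfolding isometry_op_def
    by (intro conjI allI nJ bounded_clinearI[where K = 1])
      (simp_all add: nJ, simp_all add: J_def join_add join_scaleC)
  then have bJ: "bounded_clinear J" by (simp add: isometry_op_def)
  have V: "isometry_op V"
    unfolding isometry_op_def
  proof (intro conjI allI bounded_clinearI[where K = 1])
    show "norm (V x) = norm x" for x
      using norm_cons[of x 0] by (simp add: V_def nJ power2_eq_iff_nonneg)
    then show "norm (V x) \<le> 1 * norm x" for x by simp
  qed (simp_all add: V_def cons_add cons_scaleC flip: bounded_clinear_add[OF bJ] bounded_clinear_scaleC[OF bJ])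
  \<comment> \<open>The difference \<open>J w - V (head w)\<close> is the image under
    \<open>J\<close> of a sequence with head 0, hence orthogonal to \<open>range V\<close>.\<close>
  have proj: "orth_proj (range V) (J w) = V (head w)" for w
  proof (rule orth_proj_eqI)
    show "cinner (J w - V (head w)) m = 0" if "m \<in> range V" for m
    proof -
      from that obtain h where m: "m = J (cons h 0)" by (auto simp: V_def)
      have "w - cons (head w) 0 = cons 0 (tail w)"
        using cons_diff[of "head w" "tail w" "head w" 0] by simp
      then show ?thesis
        by (simp add: m V_def isometry_cinner[OF J] cinner_cons flip: bounded_clinear_diff[OF bJ])
    qed
    show "x - y \<in> range V" if "x \<in> range V" "y \<in> range V" for x y
      using V that by (intro range_diff) (auto simp: isometry_op_def)
  qed simp

  \<comment> \<open>Compression of rational functions of \<open>N\<close> and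
    \<open>F N F\<close>\<close>
  have NJ: "N (J x) = J (Y x)" for x
    by (simp add: N_def J_def U(5) bounded_clinear_0[OF bX(2)])
  define C where "C = F \<circ> N \<circ> F"
  have bC: "bounded_clinear C"
    unfolding C_def o_def by (intro bounded_clinear_compose[OF bF] bounded_clinear_compose[OF bN] bF)
  \<comment> \<open>On the first summand \<open>F N F\<close> acts as \<open>r X'\<close>, and
    \<open>X'\<close> undoes \<open>Z\<close>. This brings vectors \<open>J (Z x)\<close> back to
    the range of \<open>J\<close>, so \<open>C\<close> is handled through its resolvents.\<close>
  have CJZ: "C (J (Z x)) = ?r *\<^sub>C J x" for x
    by (simp add: C_def N_def J_def F_join join_scaleC bounded_clinear_0[OF bU(1)] X(3) flip: X(5))
  have NT: "compresses J N T"
    unfolding compresses_def using NJ Y(2) by blast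

  have outer: "invertible_op (poly_op q N) \<and> invertible_op (poly_op q T) \<and>
      compresses J (inv (poly_op q N)) (inv (poly_op q T))"
    if q: "\<And>z. poly q z = 0 \<Longrightarrow> z \<notin> cball 0 1" for q
  proof (rule poly_op_invertible_compresses_inv[OF bJ bN bT])
    show "q \<noteq> 0" using q[of 0] by auto
    fix z assume "poly q z = 0"
    then have z: "1 < cmod z" using q[of z] by simp
    show iN: "invertible_op (\<lambda>x. N x - z *\<^sub>C x)" using z r by (intro N_shift) auto
    show iT: "invertible_op (\<lambda>x. T x - z *\<^sub>C x)"
      by (rule contraction_minus_scaleC_invertible[OF bT leT z])
    \<comment> \<open>As \<open>1 < cmod z\<close>, the isometry \<open>Y\<close> has a resolvent at
      \<open>z\<close>, which \<open>J\<close> carries into that of \<open>N\<close>.\<close>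
    have iY: "invertible_op (\<lambda>x. Y x - z *\<^sub>C x)"
      by (rule contraction_minus_scaleC_invertible[OF bY leY z])
    define R where "R = inv (\<lambda>x. Y x - z *\<^sub>C x)"
    have R: "Y (R x) - z *\<^sub>C R x = x" for x
      unfolding R_def by (rule invertible_op_inv_right[OF iY])
    show "compresses J (inv (\<lambda>x. N x - z *\<^sub>C x)) (inv (\<lambda>x. T x - z *\<^sub>C x))"
    proof (rule compresses_inv[OF iN iT])
      show "N (J (R x)) - z *\<^sub>C J (R x) = J x" for x
        by (simp add: NJ R flip: bounded_clinear_diff[OF bJ] bounded_clinear_scaleC[OF bJ])
      show "T (head (R x)) - z *\<^sub>C head (R x) = head x" for x
        by (simp add: R flip: Y(2) head_linear)
    qed
  qed
  have inner: "invertible_op (poly_op q C) \<and> invertible_op (poly_op q T) \<and>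
      compresses J (inv (poly_op q C)) (inv (poly_op q T))"
    if q: "\<And>z. poly q z = 0 \<Longrightarrow> z \<in> ball 0 r" for q
  proof (rule poly_op_invertible_compresses_inv[OF bJ bC bT])
    show "q \<noteq> 0" using q[of 1] r by auto
    fix z assume "poly q z = 0"
    then have z: "cmod z < cmod ?r" using q[of z] r by simp
    have "invertible_op (\<lambda>x. F (N (F x) - z *\<^sub>C F x))"
      using z r by (intro invertible_op_compose(1)[OF iF] invertible_op_compose(1)[OF N_shift iF]) auto
    then show iC: "invertible_op (\<lambda>x. C x - z *\<^sub>C x)"
      by (simp add: C_def bounded_clinear_diff[OF bF] bounded_clinear_scaleC[OF bF] FF)
    \<comment> \<open>Factorization \<open>T - z = r^-1 T (r - z S)\<close>, where
      \<open>cmod z < r\<close> makes \<open>r - z S\<close> invertible.\<close>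
    have "invertible_op (\<lambda>x. inverse ?r *\<^sub>C T (?r *\<^sub>C x - z *\<^sub>C S x))"
      using r by (intro invertible_op_scaleC
          invertible_op_compose(1)[OF T contraction_scaleC_minus_invertible[OF bS leS z]]) auto
    moreover have "inverse ?r * (z * ?r) = z" using r by simp
    ultimately show iT: "invertible_op (\<lambda>x. T x - z *\<^sub>C x)"
      using r by (simp add: bounded_clinear_diff[OF bT] bounded_clinear_scaleC[OF bT] TS
          scaleC_diff_right scaleC_scaleC)
    have iZ: "invertible_op (\<lambda>x. ?r *\<^sub>C x - z *\<^sub>C Z x)"
      by (rule contraction_scaleC_minus_invertible[OF bZ leZ z])
    \<comment> \<open>The witness is \<open>Z\<close> after \<open>Q\<close>: by \<open>CJZ\<close>,
      \<open>(C - z) J Z Q = J (r - z Z) Q = J\<close>. On heads the same computation uses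
      \<open>T S = r\<close>.\<close>
    define Q where "Q = inv (\<lambda>x. ?r *\<^sub>C x - z *\<^sub>C Z x)"
    have Q: "?r *\<^sub>C Q x - z *\<^sub>C Z (Q x) = x" for x
      unfolding Q_def by (rule invertible_op_inv_right[OF iZ])
    show "compresses J (inv (\<lambda>x. C x - z *\<^sub>C x)) (inv (\<lambda>x. T x - z *\<^sub>C x))"
    proof (rule compresses_inv[OF iC iT])
      show "C (J (Z (Q x))) - z *\<^sub>C J (Z (Q x)) = J x" for x
        by (simp add: CJZ Q flip: bounded_clinear_diff[OF bJ] bounded_clinear_scaleC[OF bJ])
      show "T (head (Z (Q x))) - z *\<^sub>C head (Z (Q x)) = head x" for x
        using arg_cong[OF Q[of x], of head] by (simp add: Z(2) TS head_linear)
    qed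
  qed
  have "V ((poly_op p T \<circ> inv (poly_op q1 T) \<circ> inv (poly_op q2 T)) h) =
      orth_proj (range V) ((poly_op p N \<circ> inv (poly_op q1 N) \<circ> inv (poly_op q2 C)) (V h))"
    if "\<And>z. poly q1 z = 0 \<Longrightarrow> z \<notin> cball 0 1" "\<And>z. poly q2 z = 0 \<Longrightarrow> z \<in> ball 0 r" for p q1 q2 h
  proof -
    have "compresses J (\<lambda>x. poly_op p N (inv (poly_op q1 N) (inv (poly_op q2 C) x)))
        (\<lambda>x. poly_op p T (inv (poly_op q1 T) (inv (poly_op q2 T) x)))"
      by (rule compresses_compose[OF compresses_poly_op[OF bJ bN bT NT]
            compresses_compose[OF outer[OF that(1), THEN conjunct2, THEN conjunct2]
              inner[OF that(2), THEN conjunct2, THEN conjunct2]]])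
    then show ?thesis
      unfolding compresses_def by (auto simp: V_def[of h] proj)
  qed
  then have "annulus_dilation r T V N F"
    unfolding annulus_dilation_def C_def[symmetric] using V unitN F outer inner by blast
  then show ?thesis by blast
qed

theorem theorem1p3:
  fixes r :: real and T :: "'h :: chilbert_space \<Rightarrow> 'h"
  assumes "0 < r" and "r < 1"
    and "bounded_clinear T" and "invertible_op T"
  shows "(T \<in> C1 r \<longleftrightarrow>
           (\<exists>(V :: 'h \<Rightarrow> (nat, 'h) l2) N F. annulus_dilation r T V N F)) \<and>
         ((\<exists>(V :: 'h \<Rightarrow> 'k :: chilbert_space) N F. annulus_dilation r T V N F) \<longrightarrow> T \<in> C1 r)"
proof (intro conjI iffI impI)
  show "\<exists>(V :: 'h \<Rightarrow> (nat, 'h) l2) N F. annulus_dilation r T V N F" if "T \<in> C1 r"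
    by (rule annulus_dilation_exists[OF assms(1,2,4) that])
\<comment> \<open>Both remaining goals are the same implication, once for the sequence space and
  once for an arbitrary Hilbert space \<open>'k\<close>.\<close>
qed (elim exE, rule annulus_dilation_imp_C1[OF assms(1,2,4)], assumption)+

end
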